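(* Suppose that $\underline{s}$ is an exponentially bounded external address and $\widetilde{\kappa}$ is a nonescaping parameter for which the singular value $\widetilde{\kappa}$ is contained in the limit set of $g_{\underline{s}}^{\widetilde{\kappa}}$. Suppose furthermore that $\kappa$ is another nonescaping parameter such that the limit set of $g_{\underline{s}}^{\kappa}$ does not contain the singular value $\kappa$ and is bounded. Then the bijection $\mathfrak{g}^{\widetilde{\kappa}}\circ(\mathfrak{g}^{\kappa})^{-1}:I(E_\kappa)\to I(E_{\widetilde{\kappa}})$ is not continuous.
   Context: For $\kappa\in\mathbb{C}$, $E_\kappa(z)=\exp(z)+\kappa$ and $I(E_\kappa)=\{z:E_\kappa^n(z)\to\infty\}$; $\kappa$ is nonescaping if $\kappa\notin I(E_\kappa)$. Model. An external address is a sequence $\underline{s}=s_1s_2s_3\dots\in\mathbb{Z}^{\mathbb{N}}$; $\sigma$ is the shift. Let $F(t)=e^t-1$ on $[0,\infty)$, $\mathcal{F}(\underline{s},t)=(\sigma(\underline{s}),F(t)-2\pi|s_2|)$, $T(\underline{s},t)=t$, $Z(\underline{s},t)=t+2\pi i s_1$. Put $\overline{X}=\{(\underline{s},t)\in\mathbb{Z}^{\mathbb{N}}\times[0,\infty): T(\mathcal{F}^n(\underline{s},t))\ge 0\ \forall n\ge 0\}$ and $X=\{(\underline{s},t)\in\overline{X}:T(\mathcal{F}^n(\underline{s},t))\to\infty\}$. For each $\underline{s}$ there is $t_{\underline{s}}\in[0,\infty]$ with $\{t:(\underline{s},t)\in\overline{X}\}=[t_{\underline{s}},\infty)$; $(\underline{s},t)\in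 X$ for $t>t_{\underline{s}}$; $\underline{s}$ is exponentially bounded if $t_{\underline{s}}<\infty$. The map $\mathfrak{g}^\kappa$ (for nonescaping $\kappa$). Choose $K>2\pi+6$ with $|\kappa|\le K$, let $Q=\max\{\log(4(K+\pi+3)),\pi+2\}$ and $Y=\{(\underline{s},t)\in\overline{X}:T(\mathcal{F}^n(\underline{s},t))\ge Q\ \forall n\ge 0\}$. Let $L_k(w)=\operatorname{Log}(w-\kappa)+2\pi i k$ (principal branch), $\mathfrak{g}_0=Z$, $\mathfrak{g}_{k+1}(\underline{s},t)=L_{s_1}(\mathfrak{g}_k(\mathcal{F}(\underline{s},t)))$. On $Y$ the $\mathfrak{g}_k$ converge uniformly to a map $\mathfrak{g}$, and $\mathfrak{g}|_{Y\cap X}$ extends uniquely to a bijection $\mathfrak{g}^\kappa:X\to I(E_\kappa)$ with $\mathfrak{g}^\kappa\circ\mathcal{F}=E_\kappa\circ\mathfrak{g}^\kappa$ that is continuous in $t$ for each fixed $\underline{s}$. The dynamic ray at an exponentially bounded address $\underline{s}$ is $g^\kappa_{\underline{s}}(t)=\mathfrak{g}^\kappa(\underline{s},t+t_{\underline{s}})$, $t>0$. Its limit set (accumulation set) is $\bigcap_{t>0}\overline{g^\kappa_{\underline{s}}((0,t))}$, with closures taken in the Riemann sphere; it is bounded if it does not contain $\infty$. *)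

theory Defs
  imports "HOL-Analysis.Analysis"
begin

section \<open>Exponential maps and escaping sets\<close>

definition exp_map :: "complex \<Rightarrow> complex \<Rightarrow> complex" where
  "exp_map \<kappa> z = exp z + \<kappa>"

definition escaping_set :: "complex \<Rightarrow> complex set" where
  "escaping_set \<kappa> = {z. filterlim (\<lambda>n. (exp_map \<kappa> ^^ n) z) at_infinity sequentially}"

definition nonescaping :: "complex \<Rightarrow> bool" where
  "nonescaping \<kappa> \<longleftrightarrow> \<kappa> \<notin> escaping_set \<kappa>"

section \<open>The model\<close>

text \<open>
  The address \<open>s\<^sub>1 s\<^sub>2 s\<^sub>3 \<dots>\<close> is indexed from zero:
  \<open>s 0\<close> is the first entry \<open>s\<^sub>1\<close> and \<open>s 1\<close> is the second entry \<open>s\<^sub>2\<close>.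
\<close>

type_synonym address = "nat \<Rightarrow> int"

definition shift :: "address \<Rightarrow> address" where
  "shift s = (\<lambda>n. s (Suc n))"

definition model_map :: "address \<times> real \<Rightarrow> address \<times> real" where
  "model_map = (\<lambda>(s, t). (shift s, (exp t - 1) - 2 * pi * \<bar>real_of_int (s 1)\<bar>))"

definition T :: "address \<times> real \<Rightarrow> real" where
  "T = (\<lambda>(s, t). t)"

definition Z :: "address \<times> real \<Rightarrow> complex" where
  "Z = (\<lambda>(s, t). of_real t + 2 * of_real pi * \<i> * of_int (s 0))"

definition Xbar :: "(address \<times> real) set" where
  "Xbar = {(s, t). 0 \<le> t \<and> (\<forall>n. 0 \<le> T ((model_map ^^ n) (s, t)))}"

definition X :: "(address \<times> real) set" where
  "X = {x \<in> Xbar. filterlim (\<lambda>n. T ((model_map ^^ n) x)) at_top sequentially}"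

text \<open>The infimum of the empty set is \<open>\<infinity>\<close>, so the value is \<open>\<infinity>\<close>
  when no potential is admissible for the address.\<close>

definition t_min :: "address \<Rightarrow> ereal" where
  "t_min s = (INF t\<in>{t. (s, t) \<in> Xbar}. ereal t)"

definition exp_bounded :: "address \<Rightarrow> bool" where
  "exp_bounded s \<longleftrightarrow> t_min s < \<infinity>"

section \<open>The bijection from the model to the escaping set\<close>

definition Q :: "real \<Rightarrow> real" where
  "Q K = max (ln (4 * (K + pi + 3))) (pi + 2)"

definition Y :: "real \<Rightarrow> (address \<times> real) set" where
  "Y K = {x \<in> Xbar. \<forall>n. Q K \<le> T ((model_map ^^ n) x)}"

definition L :: "complex \<Rightarrow> int \<Rightarrow> complex \<Rightarrow> complex" where
  "L \<kappa> k w = Ln (w - \<kappa>) + 2 * of_real pi * \<i> * of_int k"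

fun g_approx :: "complex \<Rightarrow> nat \<Rightarrow> address \<times> real \<Rightarrow> complex" where
  "g_approx \<kappa> 0 x = Z x"
| "g_approx \<kappa> (Suc k) x = L \<kappa> (fst x 0) (g_approx \<kappa> k (model_map x))"

definition g_lim :: "complex \<Rightarrow> address \<times> real \<Rightarrow> complex" where
  "g_lim \<kappa> x = lim (\<lambda>k. g_approx \<kappa> k x)"

text \<open>
  The conditions that single out the map for a given choice of the constant \<open>K\<close>.
  They determine \<open>G\<close> on \<open>X\<close>, and the resulting map does not depend on \<open>K\<close>.
\<close>

definition is_g_frak :: "complex \<Rightarrow> real \<Rightarrow> (address \<times> real \<Rightarrow> complex) \<Rightarrow> bool" where
  "is_g_frak \<kappa> K G \<longleftrightarrow>
     (\<forall>x \<in> Y K \<inter> X. G x = g_lim \<kappa> x) \<and>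
     bij_betw G X (escaping_set \<kappa>) \<and>
     (\<forall>x \<in> X. G (model_map x) = exp_map \<kappa> (G x)) \<and>
     (\<forall>s. continuous_on {t. (s, t) \<in> X} (\<lambda>t. G (s, t)))"

text \<open>
  For nonescaping \<open>\<kappa>\<close>, the map exists and is unique on \<open>X\<close>. Its values
  off \<open>X\<close> are unspecified, hence \<open>SOME\<close> rather than \<open>THE\<close>.
\<close>

definition g_frak :: "complex \<Rightarrow> address \<times> real \<Rightarrow> complex" where
  "g_frak \<kappa> = (SOME G. \<exists>K. K > 2 * pi + 6 \<and> norm \<kappa> \<le> K \<and> is_g_frak \<kappa> K G)"

section \<open>Dynamic rays and their limit sets\<close>

text \<open>Only meaningful for exponentially bounded \<open>s\<close> and \<open>t > 0\<close>.\<close>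

definition ray :: "complex \<Rightarrow> address \<Rightarrow> real \<Rightarrow> complex" where
  "ray \<kappa> s t = g_frak \<kappa> (s, t + real_of_ereal (t_min s))"

text \<open>
  The Riemann sphere is the one-point compactification of the plane:
  \<open>Some z\<close> is the finite point \<open>z\<close> and \<open>None\<close> is \<open>\<infinity>\<close>.
\<close>

definition riemann_sphere :: "complex option topology" where
  "riemann_sphere = Alexandroff_compactification euclidean"

definition limit_set :: "complex \<Rightarrow> address \<Rightarrow> complex option set" where
  "limit_set \<kappa> s = (\<Inter>t\<in>{0<..}. riemann_sphere closure_of (Some ` ray \<kappa> s ` {0<..<t}))"

end

theory Submission
  imports Defs
begin

text \<open>
  The limit map on \<open>Y\<close> comes from the contraction of the branches \<open>L\<close> on balls of fixed radius about
  the model points. It extends to \<open>X\<close> because a nonescaping singular value is never met by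
  a curve of escaping points, so that such curves have continuous logarithms.

  For the discontinuity, let \<open>\<Phi> = g_frak \<kappa>' \<circ> (g_frak \<kappa>)\<inverse>\<close> and choose parameters \<open>u \<rightarrow> 0\<close> at which the
  ray of \<open>s\<close> for \<open>\<kappa>'\<close> tends to \<open>\<kappa>'\<close>. In the plane of \<open>\<kappa>\<close> the logarithms \<open>b\<close> of the
  corresponding values of \<open>ray \<kappa> s u - \<kappa>\<close> stay bounded. Hence for an escaping point \<open>z\<close> with orbit far
  to the right and given \<open>n\<close>, a translate of \<open>b\<close> by a multiple of \<open>2\<pi>i\<close> has modulus comparable
  to \<open>E\<^sup>n\<^sup>+\<^sup>1 z\<close>, and pulling it back along the orbit of \<open>z\<close> gives a point \<open>y\<close> exponentially close to \<open>z\<close>.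
  By the conjugacies, \<open>E\<^sup>n\<^sup>+\<^sup>1 (\<Phi> y)\<close> is some logarithm of \<open>ray \<kappa>' s u - \<kappa>'\<close>, hence arbitrarily large for
  fixed \<open>n\<close>, and so is \<open>\<Phi> y\<close>.
\<close>

section \<open>Complex logarithms\<close>

text \<open>Mean value inequality: the derivative \<open>inverse w\<close> of \<open>Ln\<close> has
  modulus at most \<open>1 / c\<close> on the convex set. All contraction estimates below rest on
  this.\<close>

lemma norm_Ln_diff_le:
  assumes "convex S" "\<And>w. w \<in> S \<Longrightarrow> w \<notin> \<real>\<^sub>\<le>\<^sub>0" "\<And>w. w \<in> S \<Longrightarrow> c \<le> norm w" "0 < c"
    and "u \<in> S" "v \<in> S"
  shows "norm (Ln u - Ln v) \<le> norm (u - v) / c"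
proof -
  have "norm (Ln u - Ln v) \<le> (1 / c) * norm (u - v)"
  proof (rule field_differentiable_bound[where S = S and f' = "\<lambda>w. inverse w"])
    show "(Ln has_field_derivative inverse w) (at w within S)" if "w \<in> S" for w
      using has_field_derivative_Ln[OF assms(2)[OF that]] has_field_derivative_at_within by blast
    show "norm (inverse w) \<le> 1 / c" if "w \<in> S" for w
      using assms(3)[OF that] \<open>0 < c\<close> by (simp add: norm_inverse inverse_eq_divide[symmetric] le_imp_inverse_le)
  qed (use assms in auto)
  then show ?thesis by simp
qed

text \<open>The difference is continuous with values in the multiples of 2 pi i, which are 2 pi
  apart; on a connected set it cannot jump.\<close>

lemma logarithms_differ_by_constant:
  fixes a b :: "'a::topological_space \<Rightarrow> complex"
  assumes "connected S" "continuous_on S a" "continuous_on S b"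
    and eq: "\<And>x. x \<in> S \<Longrightarrow> exp (a x) = exp (b x)"
    and "x \<in> S" "y \<in> S"
  shows "a x - b x = a y - b y"
proof -
  have "(\<lambda>x. a x - b x) constant_on S"
  proof (rule continuous_discrete_range_constant[OF \<open>connected S\<close>])
    show "continuous_on S (\<lambda>x. a x - b x)"
      by (intro continuous_intros assms)
    have int: "\<exists>n::int. a x - b x = of_int n * (2 * of_real pi * \<i>)" if "x \<in> S" for x
      using eq[OF that] by (auto simp: exp_eq mult_ac)
    show "\<exists>e>0. \<forall>v. v \<in> S \<and> a v - b v \<noteq> a u - b u \<longrightarrow> e \<le> norm (a v - b v - (a u - b u))"
      if "u \<in> S" for u
    proof (intro exI[of _ "2 * pi"] conjI allI impI)
      fix v assume v: "v \<in> S \<and> a v - b v \<noteq> a u - b u"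
      obtain m n :: int where mn: "a u - b u = of_int n * (2 * of_real pi * \<i>)"
        "a v - b v = of_int m * (2 * of_real pi * \<i>)"
        using int \<open>u \<in> S\<close> v by meson
      then have "m \<noteq> n" using v by auto
      have "a v - b v - (a u - b u) = of_int (m - n) * (2 * of_real pi * \<i>)"
        unfolding mn by (simp add: algebra_simps)
      then have "norm (a v - b v - (a u - b u)) = \<bar>real_of_int (m - n)\<bar> * (2 * pi)"
        by (simp only: norm_mult norm_of_int) simp
      moreover have "1 \<le> \<bar>real_of_int (m - n)\<bar>" using \<open>m \<noteq> n\<close> by linarith
      ultimately show "2 * pi \<le> norm (a v - b v - (a u - b u))"
        using mult_right_mono[of 1 "\<bar>real_of_int (m - n)\<bar>" "2 * pi"] by simp
    qed simp
  qed
  then show ?thesis using \<open>x \<in> S\<close> \<open>y \<in> S\<close> unfolding constant_on_def by metis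
qed

section \<open>The exponential map\<close>

lemma exp_map_L: "w \<noteq> \<kappa> \<Longrightarrow> exp_map \<kappa> (L \<kappa> k w) = w"
  by (simp add: exp_map_def L_def exp_add exp_integer_2pi mult_ac)

lemma funpow_Suc_apply: "(f ^^ n) (f x) = (f ^^ Suc n) x"
  by (simp add: funpow_Suc_right del: funpow.simps)

lemma exp_map_escaping_iff: "exp_map \<kappa> z \<in> escaping_set \<kappa> \<longleftrightarrow> z \<in> escaping_set \<kappa>"
  unfolding escaping_set_def mem_Collect_eq funpow_Suc_apply
  by (rule filterlim_sequentially_Suc)

lemma exp_map_iter_escaping_iff:
  "(exp_map \<kappa> ^^ n) z \<in> escaping_set \<kappa> \<longleftrightarrow> z \<in> escaping_set \<kappa>"
  by (induction n) (simp_all add: exp_map_escaping_iff)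

text \<open>The modulus of the next iterate is at most \<open>exp (Re z) + norm \<kappa>\<close>, so
  it can be large only if the current real part is.\<close>

lemma Re_escaping_at_top:
  assumes "z \<in> escaping_set \<kappa>"
  shows "filterlim (\<lambda>n. Re ((exp_map \<kappa> ^^ n) z)) at_top sequentially"
  unfolding filterlim_at_top
proof
  fix B :: real
  have "filterlim (\<lambda>n. (exp_map \<kappa> ^^ Suc n) z) at_infinity sequentially"
    using assms unfolding escaping_set_def mem_Collect_eq
    by (subst filterlim_sequentially_Suc)
  then have "eventually (\<lambda>n. exp B + norm \<kappa> \<le> norm ((exp_map \<kappa> ^^ Suc n) z)) sequentially"
    by (auto simp: filterlim_at_infinity[OF order_refl] add_pos_nonneg)
  then show "eventually (\<lambda>n. B \<le> Re ((exp_map \<kappa> ^^ n) z)) sequentially"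
  proof eventually_elim
    case (elim n)
    have "norm ((exp_map \<kappa> ^^ Suc n) z) \<le> exp (Re ((exp_map \<kappa> ^^ n) z)) + norm \<kappa>"
      using norm_triangle_ineq[of "exp ((exp_map \<kappa> ^^ n) z)" \<kappa>] by (simp add: exp_map_def)
    then have "exp B \<le> exp (Re ((exp_map \<kappa> ^^ n) z))" using elim by linarith
    then show ?case by simp
  qed
qed

lemma escaping_large_orbit:
  assumes "z \<in> escaping_set \<kappa>"
  obtains N where "\<And>n. R \<le> Re ((exp_map \<kappa> ^^ (n + N)) z)"
  using Re_escaping_at_top[OF assms]
  unfolding filterlim_at_top eventually_sequentially by (metis le_add2)

lemma escaping_if_Re_at_top:
  assumes "filterlim (\<lambda>n. Re ((exp_map \<kappa> ^^ n) z)) at_top sequentially"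
  shows "z \<in> escaping_set \<kappa>"
  unfolding escaping_set_def mem_Collect_eq filterlim_at_infinity[OF order_refl]
proof (intro allI impI)
  fix r :: real
  have "eventually (\<lambda>n. r \<le> Re ((exp_map \<kappa> ^^ n) z)) sequentially"
    using assms unfolding filterlim_at_top by blast
  then show "eventually (\<lambda>n. r \<le> norm ((exp_map \<kappa> ^^ n) z)) sequentially"
    by eventually_elim (use complex_Re_le_cmod order_trans in blast)
qed

section \<open>The model map\<close>

lemma T_pair [simp]: "T (s, t) = t"
  by (simp add: T_def)

lemma model_map_pair: "model_map (s, t) = (shift s, exp t - 1 - 2 * pi * \<bar>real_of_int (s 1)\<bar>)"
  by (simp add: model_map_def)

lemma fst_model_map_iter: "fst ((model_map ^^ n) x) = (\<lambda>m. fst x (m + n))"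
  by (induction n) (auto simp: model_map_def shift_def split: prod.split)

lemma model_map_iter_pair:
  "(model_map ^^ n) (s, t) = (\<lambda>m. s (m + n), T ((model_map ^^ n) (s, t)))"
  by (rule prod_eqI) (simp_all add: fst_model_map_iter T_def split_beta)

lemma T_model_map_Suc:
  "T ((model_map ^^ Suc n) (s, t)) =
     exp (T ((model_map ^^ n) (s, t))) - 1 - 2 * pi * \<bar>real_of_int (s (Suc n))\<bar>"
proof -
  obtain a where a: "(model_map ^^ n) (s, t) = (\<lambda>m. s (m + n), a)"
    using model_map_iter_pair by blast
  then show ?thesis by (simp add: model_map_pair)
qed

lemma T_ge_all_iff:
  "(\<forall>n. c \<le> T ((model_map ^^ n) x)) \<longleftrightarrow> c \<le> T x \<and> (\<forall>n. c \<le> T ((model_map ^^ n) (model_map x)))"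
proof (intro iffI conjI allI)
  fix n assume "c \<le> T x \<and> (\<forall>n. c \<le> T ((model_map ^^ n) (model_map x)))"
  then show "c \<le> T ((model_map ^^ n) x)" by (cases n) (simp_all add: funpow_swap1)
next
  assume *: "\<forall>n. c \<le> T ((model_map ^^ n) x)"
  show "c \<le> T x" using *[rule_format, of 0] by simp
  show "c \<le> T ((model_map ^^ n) (model_map x))" for n
    using *[rule_format, of "Suc n"] by (simp only: funpow_Suc_apply)
qed

lemma mem_Xbar_iff: "x \<in> Xbar \<longleftrightarrow> (\<forall>n. 0 \<le> T ((model_map ^^ n) x))"
  by (cases x) (auto simp: Xbar_def dest: spec[of _ 0])

lemma mem_X_iff:
  "x \<in> X \<longleftrightarrow> (\<forall>n. 0 \<le> T ((model_map ^^ n) x)) \<and>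
     filterlim (\<lambda>n. T ((model_map ^^ n) x)) at_top sequentially"
  by (simp add: X_def mem_Xbar_iff)

lemma X_subset_Xbar: "X \<subseteq> Xbar"
  by (auto simp: X_def)

lemma model_map_mem_X_iff: "x \<in> X \<longleftrightarrow> 0 \<le> T x \<and> model_map x \<in> X"
proof -
  have "filterlim (\<lambda>n. T ((model_map ^^ n) (model_map x))) at_top sequentially
    \<longleftrightarrow> filterlim (\<lambda>n. T ((model_map ^^ n) x)) at_top sequentially"
    unfolding funpow_Suc_apply
    by (rule filterlim_sequentially_Suc[of "\<lambda>n. T ((model_map ^^ n) x)"])
  then show ?thesis
    unfolding mem_X_iff using T_ge_all_iff[of 0 x] by blast
qed

lemma model_map_mem_X: "x \<in> X \<Longrightarrow> model_map x \<in> X"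
  using model_map_mem_X_iff by blast

lemma model_map_iter_mem_X: "x \<in> X \<Longrightarrow> (model_map ^^ n) x \<in> X"
  by (induction n) (simp_all add: model_map_mem_X)

text \<open>Both points have the same address, so the subtracted terms cancel and the gap changes
  only through exp. Above 0 the linear Taylor term preserves the gap, and the quadratic term adds at
  least \<open>(u - t)\<^sup>2 / 2\<close> at every step. This linear growth yields both escape and
  injectivity later.\<close>

lemma T_gap:
  assumes "\<And>m. m < n \<Longrightarrow> 0 \<le> T ((model_map ^^ m) (s, t))" "t \<le> u"
  shows "T ((model_map ^^ n) (s, t)) + (u - t) + real n * (u - t)\<^sup>2 / 2 \<le> T ((model_map ^^ n) (s, u))"
  using assms(1)
proof (induction n)
  case (Suc n)
  define a where "a = T ((model_map ^^ n) (s, t))"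
  define b where "b = T ((model_map ^^ n) (s, u))"
  have a: "0 \<le> a" using Suc.prems[of n] by (simp add: a_def)
  have gap: "(u - t) + real n * (u - t)\<^sup>2 / 2 \<le> b - a"
    using Suc by (simp add: a_def b_def)
  have le: "u - t \<le> b - a" using gap by (smt (verit) divide_nonneg_nonneg of_nat_0_le_iff mult_nonneg_nonneg zero_le_power2)
  have "(b - a) + (b - a)\<^sup>2 / 2 \<le> exp (b - a) - 1"
    using exp_lower_Taylor_quadratic[of "b - a"] le \<open>t \<le> u\<close> by simp
  also have "\<dots> \<le> exp a * (exp (b - a) - 1)"
    using a le \<open>t \<le> u\<close> mult_right_mono[of 1 "exp a" "exp (b - a) - 1"] by simp
  also have "\<dots> = exp b - exp a" by (simp add: algebra_simps exp_diff)
  finally have "(b - a) + (b - a)\<^sup>2 / 2 \<le> exp b - exp a" .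
  moreover have "(u - t)\<^sup>2 \<le> (b - a)\<^sup>2" using le \<open>t \<le> u\<close> by (intro power_mono) auto
  ultimately have "(u - t) + real (Suc n) * (u - t)\<^sup>2 / 2 \<le> exp b - exp a"
    using gap by (simp add: field_simps)
  then show ?case unfolding T_model_map_Suc a_def[symmetric] b_def[symmetric] by simp
qed simp

lemma T_mono:
  assumes "(s, t) \<in> Xbar" "t \<le> u"
  shows "T ((model_map ^^ n) (s, t)) + (u - t) \<le> T ((model_map ^^ n) (s, u))"
proof -
  have "0 \<le> real n * (u - t)\<^sup>2 / 2" by simp
  moreover have "T ((model_map ^^ n) (s, t)) + (u - t) + real n * (u - t)\<^sup>2 / 2 \<le> T ((model_map ^^ n) (s, u))"
    using assms by (intro T_gap) (auto simp: mem_Xbar_iff)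
  ultimately show ?thesis by linarith
qed

lemma X_if_greater:
  assumes "(s, t) \<in> Xbar" "t < u"
  shows "(s, u) \<in> X"
proof -
  have nonneg: "0 \<le> T ((model_map ^^ n) (s, t))" for n using assms by (simp add: mem_Xbar_iff)
  have ge: "real n * ((u - t)\<^sup>2 / 2) \<le> T ((model_map ^^ n) (s, u))" for n
    using T_gap[OF nonneg less_imp_le[OF assms(2)], of n] nonneg[of n] assms(2)
    unfolding times_divide_eq_right by linarith
  have "filterlim (\<lambda>n. real n * ((u - t)\<^sup>2 / 2)) at_top sequentially"
    using assms(2)
    by (intro filterlim_at_top_mult_tendsto_pos[OF tendsto_const _ filterlim_real_sequentially]) auto
  then have "filterlim (\<lambda>n. T ((model_map ^^ n) (s, u))) at_top sequentially"
    by (rule filterlim_at_top_mono) (use ge in auto)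
  moreover have "0 \<le> T ((model_map ^^ n) (s, u))" for n
    using T_mono[OF assms(1), of u n] nonneg[of n] assms(2) by simp
  ultimately show ?thesis by (simp add: mem_X_iff)
qed

lemma X_upward_closed: "(s, t) \<in> X \<Longrightarrow> t \<le> u \<Longrightarrow> (s, u) \<in> X"
  using X_if_greater[of s t u] X_subset_Xbar by (cases "t = u") auto

section \<open>Orbits that stay above the threshold \<open>Q\<close>\<close>

lemma Q_gt: "pi + 2 \<le> Q K"
  by (simp add: Q_def)

lemma Q_nonneg: "0 \<le> Q K"
  using Q_gt[of K] pi_gt_zero by linarith

lemma mem_Y_iff: "x \<in> Y K \<longleftrightarrow> (\<forall>n. Q K \<le> T ((model_map ^^ n) x))"
  using Q_nonneg[of K] by (auto simp: Y_def mem_Xbar_iff intro: order_trans)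

lemma Y_subset_Xbar: "Y K \<subseteq> Xbar"
  by (auto simp: Y_def)

lemma model_map_mem_Y_iff: "x \<in> Y K \<longleftrightarrow> Q K \<le> T x \<and> model_map x \<in> Y K"
  unfolding mem_Y_iff using T_ge_all_iff by blast

lemma model_map_mem_Y: "x \<in> Y K \<Longrightarrow> model_map x \<in> Y K"
  using model_map_mem_Y_iff by blast

lemma model_map_iter_mem_Y: "x \<in> Y K \<Longrightarrow> (model_map ^^ n) x \<in> Y K"
  by (induction n) (simp_all add: model_map_mem_Y)

lemma Y_upward_closed: "(s, t) \<in> Y K \<Longrightarrow> t \<le> u \<Longrightarrow> (s, u) \<in> Y K"
  using T_mono[of s t u] Y_subset_Xbar[of K] mem_Y_iff[of "(s, t)"] mem_Y_iff[of "(s, u)"]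
  by (smt (verit) subsetD)

lemma Y_if_Q_greater:
  assumes "(s, t) \<in> Xbar" "t + Q K \<le> u"
  shows "(s, u) \<in> Y K"
  unfolding mem_Y_iff
proof
  fix n
  have "0 \<le> T ((model_map ^^ n) (s, t))" using assms by (simp add: mem_Xbar_iff)
  then show "Q K \<le> T ((model_map ^^ n) (s, u))"
    using T_mono[OF assms(1), of u n] assms(2) Q_nonneg[of K] by linarith
qed

lemma X_eventually_Y:
  assumes "x \<in> X"
  obtains N where "\<And>n. N \<le> n \<Longrightarrow> (model_map ^^ n) x \<in> Y K"
proof -
  have "eventually (\<lambda>n. Q K \<le> T ((model_map ^^ n) x)) sequentially"
    using assms unfolding mem_X_iff filterlim_at_top by blast
  then obtain N where N: "\<And>n. N \<le> n \<Longrightarrow> Q K \<le> T ((model_map ^^ n) x)"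
    unfolding eventually_sequentially by blast
  show thesis
  proof
    show "(model_map ^^ n) x \<in> Y K" if "N \<le> n" for n
      unfolding mem_Y_iff
      using N that by (metis funpow_add comp_apply trans_le_add2)
  qed
qed

section \<open>Convergence of the approximations\<close>

locale exp_parameter =
  fixes \<kappa> :: complex and K :: real
  assumes K_gt: "2 * pi + 6 < K" and norm_le_K: "norm \<kappa> \<le> K"
begin

lemma K_gt_6: "6 < K"
  using K_gt pi_gt_zero by linarith

lemma norm_bounds_near_model:
  fixes b t :: real and k :: int
  assumes b: "0 \<le> b" and t: "exp t = b + 1 + 2 * pi * \<bar>real_of_int k\<bar>"
    and large: "4 * (K + pi + 3) \<le> exp t"
    and w: "norm (w - (of_real b + 2 * of_real pi * \<i> * of_int k)) \<le> pi + 2"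
  shows "2 / 5 * exp t \<le> norm (w - \<kappa>)" "norm (w - \<kappa>) \<le> 5 / 4 * exp t"
proof -
  define c where "c = of_real b + 2 * of_real pi * \<i> * of_int k"
  define y where "y = 2 * pi * \<bar>real_of_int k\<bar>"
  have y: "0 \<le> y" by (simp add: y_def)
  have norm_c: "norm c = sqrt (b\<^sup>2 + y\<^sup>2)"
    by (simp add: c_def y_def cmod_def power_mult_distrib)
  \<comment> \<open>The factor 7/10 lies just below 1 / sqrt 2, the best constant between the
    Euclidean norm and the sum of the coordinates.\<close>
  have "(7 / 10 * (b + y))\<^sup>2 \<le> b\<^sup>2 + y\<^sup>2"
    using zero_le_power2[of "b - y"] zero_le_power2[of b] zero_le_power2[of y]
    unfolding power2_sum power2_diff power_mult_distrib power2_eq_square by argo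
  then have lower: "7 / 10 * (b + y) \<le> norm c"
    unfolding norm_c by (rule real_le_rsqrt)
  have upper: "norm c \<le> b + y"
    unfolding norm_c using b y by (intro real_le_lsqrt) (auto simp: power2_sum)
  have "norm (w - \<kappa> - c) \<le> pi + 2 + K"
    using norm_triangle_ineq4[of "w - c" \<kappa>] w norm_le_K by (simp add: c_def algebra_simps)
  then have diff: "\<bar>norm (w - \<kappa>) - norm c\<bar> \<le> pi + 2 + K"
    using norm_triangle_ineq3[of "w - \<kappa>" c] by linarith
  have "exp t = b + 1 + y" using t by (simp add: y_def)
  \<comment> \<open>The displacement by \<kappa> and by the radius is thus at most a quarter of
    \<open>exp t\<close>, leaving 7/10 - 1/4 > 2/5 below and 1 + 1/4 above.\<close>
  moreover have "K + pi + 3 \<le> exp t / 4" using large by simp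
  moreover have "7 / 10 * (b + y) = 7 / 10 * b + 7 / 10 * y" by (simp add: distrib_left)
  ultimately show "2 / 5 * exp t \<le> norm (w - \<kappa>)" "norm (w - \<kappa>) \<le> 5 / 4 * exp t"
    using lower upper diff b y by linarith+
qed

lemma Re_Ln_near_model:
  fixes b t :: real and k :: int
  assumes "0 \<le> b" "exp t = b + 1 + 2 * pi * \<bar>real_of_int k\<bar>"
    and "4 * (K + pi + 3) \<le> exp t"
    and "norm (w - (of_real b + 2 * of_real pi * \<i> * of_int k)) \<le> pi + 2"
  shows "\<bar>ln (norm (w - \<kappa>)) - t\<bar> \<le> 1" "w \<noteq> \<kappa>"
proof -
  note bounds = norm_bounds_near_model[OF assms]
  have pos: "0 < norm (w - \<kappa>)" by (rule less_le_trans[OF _ bounds(1)]) simp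
  then show "w \<noteq> \<kappa>" by auto
  \<comment> \<open>With e at least 5/2, the factors 2/5 and 5/4 lie between 1/e and e, so the
    logarithm moves by at most 1.\<close>
  have e: "5 / 2 \<le> exp (1::real)" using exp_lower_Taylor_quadratic[of "1::real"] by simp
  have "norm (w - \<kappa>) \<le> exp (t + 1)"
    using bounds(2) exp_gt_zero[of t] mult_left_mono[OF e, of "exp t"] unfolding exp_add by linarith
  moreover have "exp (t - 1) \<le> norm (w - \<kappa>)"
  proof -
    have "exp (-1::real) \<le> 2 / 5" using e by (simp add: exp_minus field_simps)
    then have "exp t * exp (-1) \<le> exp t * (2 / 5)" by (intro mult_left_mono) auto
    moreover have "exp (t - 1) = exp t * exp (-1)" using exp_add[of t "-1"] by simp
    ultimately show ?thesis using bounds(1) by linarith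
  qed
  ultimately have "ln (norm (w - \<kappa>)) \<le> t + 1" "t - 1 \<le> ln (norm (w - \<kappa>))"
    using pos ln_le_cancel_iff[OF pos, of "exp (t + 1)"] by (simp_all add: ln_ge_iff)
  then show "\<bar>ln (norm (w - \<kappa>)) - t\<bar> \<le> 1" by linarith
qed

text \<open>The radius exceeds 1 + pi, where 1 bounds the error in the real part and pi the
  imaginary part of a principal logarithm; hence the branches \<open>L\<close> map these discs into
  each other. Since \<open>Q\<close> is at least \<open>pi + 2\<close>, discs about points of
  \<open>Y\<close> lie in the closed right half-plane.\<close>

definition nbhd :: "address \<times> real \<Rightarrow> complex set" where
  "nbhd x = cball (Z x) (pi + 2)"

lemma mem_nbhd_iff: "w \<in> nbhd x \<longleftrightarrow> norm (w - Z x) \<le> pi + 2"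
  by (simp add: nbhd_def dist_norm norm_minus_commute)

lemma Z_eq: "Z x = of_real (T x) + 2 * of_real pi * \<i> * of_int (fst x 0)"
  by (simp add: Z_def T_def split_beta)

lemma T_mem_Y:
  assumes "x \<in> Y K"
  shows "pi + 2 \<le> T x" "4 * (K + pi + 3) \<le> exp (T x)"
proof -
  have "Q K \<le> T x" using assms model_map_mem_Y_iff by blast
  moreover have "0 < 4 * (K + pi + 3)" using K_gt_6 by (simp add: add_pos_pos)
  ultimately show "pi + 2 \<le> T x" "4 * (K + pi + 3) \<le> exp (T x)"
    using ln_le_cancel_iff[of "4 * (K + pi + 3)" "exp (T x)"] by (auto simp: Q_def)
qed

lemma exp_T:
  "exp (T x) = T (model_map x) + 1 + 2 * pi * \<bar>real_of_int (fst (model_map x) 0)\<bar>"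
  by (simp add: T_def model_map_def shift_def split_beta)

lemma
  assumes "x \<in> Y K" "w \<in> nbhd (model_map x)"
  shows norm_bound_nbhd: "2 / 5 * exp (T x) \<le> norm (w - \<kappa>)"
    and Re_Ln_nbhd: "\<bar>ln (norm (w - \<kappa>)) - T x\<bar> \<le> 1"
    and nbhd_not_kappa: "w \<noteq> \<kappa>"
proof -
  have "0 \<le> T (model_map x)"
    using T_mem_Y(1)[OF model_map_mem_Y[OF assms(1)]] pi_gt_zero by linarith
  note est = this exp_T[of x] T_mem_Y(2)[OF assms(1)] assms(2)[unfolded mem_nbhd_iff Z_eq]
  show "2 / 5 * exp (T x) \<le> norm (w - \<kappa>)" by (rule norm_bounds_near_model[OF est])
  show "\<bar>ln (norm (w - \<kappa>)) - T x\<bar> \<le> 1" "w \<noteq> \<kappa>" by (rule Re_Ln_near_model[OF est])+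
qed

text \<open>A point of the slit has real part in \<open>[0, Re \<kappa>]\<close>, hence is too close to \<open>\<kappa>\<close>.\<close>

lemma nbhd_avoids_slit:
  assumes x: "x \<in> Y K" and w: "w \<in> nbhd (model_map x)"
  shows "w - \<kappa> \<notin> \<real>\<^sub>\<le>\<^sub>0"
proof
  assume slit: "w - \<kappa> \<in> \<real>\<^sub>\<le>\<^sub>0"
  have "\<bar>Re (w - Z (model_map x))\<bar> \<le> pi + 2"
    using w abs_Re_le_cmod order_trans unfolding mem_nbhd_iff by blast
  then have "0 \<le> Re w"
    using T_mem_Y(1)[OF model_map_mem_Y[OF x]] by (simp add: Z_eq)
  moreover have "Re w \<le> Re \<kappa>" "Im w = Im \<kappa>" using slit by (auto simp: complex_nonpos_Reals_iff)
  moreover have "Re \<kappa> \<le> K" using complex_Re_le_cmod[of \<kappa>] norm_le_K by linarith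
  ultimately have "norm (w - \<kappa>) \<le> K" by (simp add: cmod_def)
  then show False
    using norm_bound_nbhd[OF x w] T_mem_Y(2)[OF x] K_gt_6 pi_gt_zero unfolding distrib_left by linarith
qed

text \<open>The derivative of the branch is 1 / (w - \<kappa>), and the modulus of w - \<kappa> is
  at least 2/5 of \<open>exp (T x)\<close>, far above 2.\<close>

lemma L_contraction:
  assumes x: "x \<in> Y K" and "u \<in> nbhd (model_map x)" "v \<in> nbhd (model_map x)"
  shows "norm (L \<kappa> k u - L \<kappa> k v) \<le> norm (u - v) / 2"
proof -
  have "norm (Ln (u - \<kappa>) - Ln (v - \<kappa>)) \<le> norm ((u - \<kappa>) - (v - \<kappa>)) / 2"
  proof (rule norm_Ln_diff_le[where S = "(\<lambda>w. w - \<kappa>) ` nbhd (model_map x)"])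
    have "(\<lambda>w. w - \<kappa>) ` nbhd (model_map x) = (\<lambda>w. - \<kappa> + w) ` nbhd (model_map x)"
      by (intro image_cong) auto
    then show "convex ((\<lambda>w. w - \<kappa>) ` nbhd (model_map x))"
      by (simp only: convex_translation_eq nbhd_def convex_cball)
    show "w \<notin> \<real>\<^sub>\<le>\<^sub>0" if "w \<in> (\<lambda>w. w - \<kappa>) ` nbhd (model_map x)" for w
      using nbhd_avoids_slit[OF x] that by auto
    show "2 \<le> norm w" if w: "w \<in> (\<lambda>w. w - \<kappa>) ` nbhd (model_map x)" for w
    proof -
      have "2 / 5 * exp (T x) \<le> norm w" using norm_bound_nbhd[OF x] w by auto
      moreover have "24 \<le> exp (T x)"
        using T_mem_Y(2)[OF x] K_gt_6 pi_gt_zero unfolding distrib_left by linarith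
      ultimately show ?thesis by linarith
    qed
  qed (use assms in auto)
  then show ?thesis by (simp add: L_def)
qed

lemma L_mem_nbhd:
  assumes x: "x \<in> Y K" and w: "w \<in> nbhd (model_map x)"
  shows "L \<kappa> (fst x 0) w \<in> nbhd x"
proof -
  have ne: "w - \<kappa> \<noteq> 0" using nbhd_not_kappa[OF x w] by simp
  have "norm (L \<kappa> (fst x 0) w - Z x) = norm (Ln (w - \<kappa>) - of_real (T x))"
    by (simp add: L_def Z_eq)
  also have "\<dots> \<le> \<bar>Re (Ln (w - \<kappa>) - of_real (T x))\<bar> + \<bar>Im (Ln (w - \<kappa>) - of_real (T x))\<bar>"
    by (rule cmod_le)
  also have "\<dots> \<le> 1 + pi"
    using Re_Ln_nbhd[OF x w] mpi_less_Im_Ln[OF ne] Im_Ln_le_pi[OF ne] ne by (intro add_mono) auto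
  finally show ?thesis by (simp add: mem_nbhd_iff)
qed

lemma g_approx_mem_nbhd: "x \<in> Y K \<Longrightarrow> g_approx \<kappa> k x \<in> nbhd x"
proof (induction k arbitrary: x)
  case 0
  then show ?case using pi_gt_zero by (simp add: mem_nbhd_iff)
next
  case (Suc k)
  then show ?case using L_mem_nbhd model_map_mem_Y by simp
qed

text \<open>At the n-th image every approximation lies within the disc radius of the model point,
  and each application of \<open>L\<close> on the way back halves the distance.\<close>

lemma g_approx_diff: "x \<in> Y K \<Longrightarrow> norm (g_approx \<kappa> (k + m) x - g_approx \<kappa> k x) \<le> (pi + 2) / 2 ^ k"
proof (induction k arbitrary: x)
  case 0
  then show ?case using g_approx_mem_nbhd[of x m] by (simp add: mem_nbhd_iff)
next
  case (Suc k)
  have F: "model_map x \<in> Y K" by (rule model_map_mem_Y[OF Suc.prems])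
  have "norm (g_approx \<kappa> (Suc k + m) x - g_approx \<kappa> (Suc k) x)
    \<le> norm (g_approx \<kappa> (k + m) (model_map x) - g_approx \<kappa> k (model_map x)) / 2"
    using L_contraction[OF Suc.prems g_approx_mem_nbhd[OF F] g_approx_mem_nbhd[OF F]] by simp
  also have "\<dots> \<le> (pi + 2) / 2 ^ k / 2"
    by (intro divide_right_mono Suc.IH[OF F]) simp
  finally show ?case by (simp add: mult_ac)
qed

lemma error_tendsto_0: "(\<lambda>k. (pi + 2) / 2 ^ k) \<longlonglongrightarrow> 0"
  using tendsto_mult_right[OF LIMSEQ_divide_realpow_zero[of 2 1], of "pi + 2"] by simp

lemma g_approx_tendsto:
  assumes x: "x \<in> Y K"
  shows "(\<lambda>k. g_approx \<kappa> k x) \<longlonglongrightarrow> g_lim \<kappa> x"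
proof -
  have "Cauchy (\<lambda>k. g_approx \<kappa> k x)"
  proof (rule metric_CauchyI)
    fix e :: real assume "0 < e"
    then have "eventually (\<lambda>n. (pi + 2) / 2 ^ n < e / 2) sequentially"
      by (intro order_tendstoD(2)[OF error_tendsto_0]) simp
    then obtain N where N: "(pi + 2) / 2 ^ N < e / 2"
      unfolding eventually_sequentially by blast
    have near: "dist (g_approx \<kappa> n x) (g_approx \<kappa> N x) < e / 2" if "N \<le> n" for n
      using g_approx_diff[OF x, of N "n - N"] that le_less_trans[OF _ N] by (simp add: dist_norm)
    show "\<exists>M. \<forall>m\<ge>M. \<forall>n\<ge>M. dist (g_approx \<kappa> m x) (g_approx \<kappa> n x) < e"
      using dist_triangle_half_l[OF near near] by blast
  qed
  then show ?thesis
    unfolding g_lim_def by (simp add: Cauchy_convergent_iff convergent_LIMSEQ_iff)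
qed

lemma g_lim_error:
  assumes x: "x \<in> Y K"
  shows "norm (g_lim \<kappa> x - g_approx \<kappa> k x) \<le> (pi + 2) / 2 ^ k"
proof (rule Lim_bounded)
  have "(\<lambda>m. g_approx \<kappa> (k + m) x) \<longlonglongrightarrow> g_lim \<kappa> x"
    using LIMSEQ_ignore_initial_segment[OF g_approx_tendsto[OF x], of k] by (simp add: add.commute)
  then show "(\<lambda>m. norm (g_approx \<kappa> (k + m) x - g_approx \<kappa> k x)) \<longlonglongrightarrow> norm (g_lim \<kappa> x - g_approx \<kappa> k x)"
    by (intro tendsto_intros)
  show "\<forall>m\<ge>0. norm (g_approx \<kappa> (k + m) x - g_approx \<kappa> k x) \<le> (pi + 2) / 2 ^ k"
    using g_approx_diff[OF x] by blast
qed

lemma g_lim_mem_nbhd: "x \<in> Y K \<Longrightarrow> g_lim \<kappa> x \<in> nbhd x"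
  using g_lim_error[of x 0] by (simp add: mem_nbhd_iff)

lemma g_lim_eq_L:
  assumes x: "x \<in> Y K"
  shows "g_lim \<kappa> x = L \<kappa> (fst x 0) (g_lim \<kappa> (model_map x))"
proof -
  note F = model_map_mem_Y[OF x]
  have "(\<lambda>k. g_approx \<kappa> (Suc k) x) \<longlonglongrightarrow> L \<kappa> (fst x 0) (g_lim \<kappa> (model_map x))"
    unfolding g_approx.simps L_def
    by (intro tendsto_intros g_approx_tendsto F nbhd_avoids_slit[OF x] g_lim_mem_nbhd)
  then show ?thesis
    using LIMSEQ_Suc[OF g_approx_tendsto[OF x]] LIMSEQ_unique by blast
qed

lemma exp_map_g_lim: "x \<in> Y K \<Longrightarrow> exp_map \<kappa> (g_lim \<kappa> x) = g_lim \<kappa> (model_map x)"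
  using g_lim_eq_L[of x] exp_map_L nbhd_not_kappa g_lim_mem_nbhd model_map_mem_Y by metis

lemma exp_map_iter_g_lim:
  "x \<in> Y K \<Longrightarrow> (exp_map \<kappa> ^^ n) (g_lim \<kappa> x) = g_lim \<kappa> ((model_map ^^ n) x)"
  by (induction n) (simp_all add: exp_map_g_lim model_map_iter_mem_Y)

section \<open>Continuity, escape and injectivity of the limit map\<close>

lemma continuous_on_g_approx: "continuous_on {t. (s, t) \<in> Y K} (\<lambda>t. g_approx \<kappa> k (s, t))"
proof (induction k arbitrary: s)
  case 0
  show ?case by (simp add: Z_def) (intro continuous_intros)
next
  case (Suc k)
  have "continuous_on {t. (s, t) \<in> Y K}
    (\<lambda>t. g_approx \<kappa> k (shift s, exp t - 1 - 2 * pi * \<bar>real_of_int (s 1)\<bar>))"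
    by (rule continuous_on_compose2[OF Suc[of "shift s"]])
      (auto intro!: continuous_intros dest: model_map_mem_Y simp: model_map_pair)
  then have "continuous_on {t. (s, t) \<in> Y K} (\<lambda>t. g_approx \<kappa> k (model_map (s, t)))"
    by (simp add: model_map_pair)
  then show ?case
    unfolding g_approx.simps L_def
    by (intro continuous_intros)
      (use nbhd_avoids_slit[OF _ g_approx_mem_nbhd[OF model_map_mem_Y]] in auto)
qed

lemma continuous_on_g_lim: "continuous_on {t. (s, t) \<in> Y K} (\<lambda>t. g_lim \<kappa> (s, t))"
proof (rule uniform_limit_theorem[where F = sequentially])
  show "uniform_limit {t. (s, t) \<in> Y K} (\<lambda>k t. g_approx \<kappa> k (s, t)) (\<lambda>t. g_lim \<kappa> (s, t)) sequentially"
    unfolding uniform_limit_iff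
  proof (intro allI impI)
    fix e :: real assume "0 < e"
    then have "eventually (\<lambda>k. (pi + 2) / 2 ^ k < e) sequentially"
      using order_tendstoD(2)[OF error_tendsto_0] by blast
    then show "\<forall>\<^sub>F k in sequentially. \<forall>t\<in>{t. (s, t) \<in> Y K}. dist (g_approx \<kappa> k (s, t)) (g_lim \<kappa> (s, t)) < e"
    proof eventually_elim
      case (elim k)
      then show ?case using g_lim_error[of _ k] by (force simp: dist_norm norm_minus_commute)
    qed
  qed
qed (simp_all add: continuous_on_g_approx)

lemma Re_g_lim: "x \<in> Y K \<Longrightarrow> \<bar>Re (g_lim \<kappa> x) - T x\<bar> \<le> pi + 2"
  using g_lim_mem_nbhd[of x] abs_Re_le_cmod[of "g_lim \<kappa> x - Z x"] by (simp add: mem_nbhd_iff Z_eq)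

lemma g_lim_escaping:
  assumes "x \<in> Y K \<inter> X"
  shows "g_lim \<kappa> x \<in> escaping_set \<kappa>"
proof (rule escaping_if_Re_at_top)
  have "filterlim (\<lambda>n. - (pi + 2) + T ((model_map ^^ n) x)) at_top sequentially"
    using assms by (intro filterlim_tendsto_add_at_top[OF tendsto_const]) (simp add: mem_X_iff)
  then show "filterlim (\<lambda>n. Re ((exp_map \<kappa> ^^ n) (g_lim \<kappa> x))) at_top sequentially"
  proof (rule filterlim_at_top_mono, intro always_eventually allI)
    fix n
    show "- (pi + 2) + T ((model_map ^^ n) x) \<le> Re ((exp_map \<kappa> ^^ n) (g_lim \<kappa> x))"
      using Re_g_lim[OF model_map_iter_mem_Y, of x n] assms exp_map_iter_g_lim[of x n] by auto
  qed
qed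

text \<open>The value is a principal logarithm shifted by the first entry, and the half-open strips
  of height 2 pi containing these values are disjoint for different entries.\<close>

lemma g_lim_address_unique:
  assumes "x \<in> Y K" "y \<in> Y K" "g_lim \<kappa> x = g_lim \<kappa> y"
  shows "fst x 0 = fst y 0"
proof -
  have Im: "- pi < Im (g_lim \<kappa> x) - 2 * pi * fst x 0 \<and> Im (g_lim \<kappa> x) - 2 * pi * fst x 0 \<le> pi"
    if "x \<in> Y K" for x
  proof -
    have "g_lim \<kappa> (model_map x) - \<kappa> \<noteq> 0"
      using nbhd_not_kappa[OF that] g_lim_mem_nbhd model_map_mem_Y that by auto
    from mpi_less_Im_Ln[OF this] Im_Ln_le_pi[OF this] show ?thesis
      by (subst (1 2) g_lim_eq_L[OF that]) (simp add: L_def)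
  qed
  have "\<bar>2 * pi * (real_of_int (fst x 0) - real_of_int (fst y 0))\<bar> < 2 * pi * 1"
    using Im[OF assms(1)] Im[OF assms(2)] assms(3) by (simp add: right_diff_distrib) linarith
  then have "\<bar>real_of_int (fst x 0) - real_of_int (fst y 0)\<bar> < 1"
    by (simp add: abs_mult)
  then show ?thesis by linarith
qed

text \<open>Equal values have equal orbits, hence equal addresses entry by entry. The potentials
  then stay within a bounded distance of each other, whereas \<open>T_gap\<close> makes different
  potentials drift apart.\<close>

lemma inj_on_g_lim: "inj_on (g_lim \<kappa>) (Y K)"
proof (rule inj_onI)
  fix x y assume x: "x \<in> Y K" and y: "y \<in> Y K" and eq: "g_lim \<kappa> x = g_lim \<kappa> y"
  have eq_n: "g_lim \<kappa> ((model_map ^^ n) x) = g_lim \<kappa> ((model_map ^^ n) y)" for n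
    using eq exp_map_iter_g_lim[OF x] exp_map_iter_g_lim[OF y] by metis
  have "fst x n = fst y n" for n
    using g_lim_address_unique[OF model_map_iter_mem_Y[OF x] model_map_iter_mem_Y[OF y] eq_n]
    by (simp add: fst_model_map_iter)
  then have fst: "fst x = fst y" by blast
  have close: "\<bar>T ((model_map ^^ n) x) - T ((model_map ^^ n) y)\<bar> \<le> 2 * (pi + 2)" for n
    using Re_g_lim[OF model_map_iter_mem_Y[OF x], of n] Re_g_lim[OF model_map_iter_mem_Y[OF y], of n]
      eq_n[of n] by auto
  have not_less: "\<not> t < u"
    if "(s, t) \<in> Xbar" and cl: "\<And>n. \<bar>T ((model_map ^^ n) (s, t)) - T ((model_map ^^ n) (s, u))\<bar> \<le> 2 * (pi + 2)"
    for s t u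
  proof
    assume "t < u"
    then obtain n where n: "2 * (pi + 2) < real n * ((u - t)\<^sup>2 / 2)"
      using reals_Archimedean3[of "(u - t)\<^sup>2 / 2", rule_format, of "2 * (pi + 2)"] by auto
    have "T ((model_map ^^ n) (s, t)) + (u - t) + real n * (u - t)\<^sup>2 / 2 \<le> T ((model_map ^^ n) (s, u))"
      using that(1) \<open>t < u\<close> by (intro T_gap) (auto simp: mem_Xbar_iff)
    then show False using n cl[of n] \<open>t < u\<close> unfolding times_divide_eq_right by linarith
  qed
  have "x = (fst x, snd x)" "y = (fst x, snd y)" using fst by (auto simp: prod_eq_iff)
  moreover have "x \<in> Xbar" "y \<in> Xbar" using x y Y_subset_Xbar by blast+
  ultimately have "\<not> snd x < snd y" "\<not> snd y < snd x"
    using not_less[of "fst x" "snd x" "snd y"] not_less[of "fst x" "snd y" "snd x"] close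
    by (metis abs_minus_commute)+
  then show "x = y" using fst by (simp add: prod_eq_iff)
qed

end

section \<open>Inverting the model map along a ray\<close>

text \<open>The inverse of the potential part of \<open>model_map\<close> on the ray of
  \<open>s\<close>. It depends on \<open>s\<close> only through the second entry, so altering the
  first one does not change it.\<close>

definition pull_back :: "address \<Rightarrow> real \<Rightarrow> real" where
  "pull_back s u = ln (u + 1 + 2 * pi * \<bar>real_of_int (s 1)\<bar>)"

lemma pull_back_arg_ge: "u + 1 \<le> u + 1 + 2 * pi * \<bar>real_of_int (s 1)\<bar>"
  by simp

lemma exp_pull_back: "0 \<le> u \<Longrightarrow> exp (pull_back s u) = u + 1 + 2 * pi * \<bar>real_of_int (s 1)\<bar>"
  using pull_back_arg_ge[of u s] unfolding pull_back_def by (intro exp_ln) linarith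

lemma model_map_pull_back: "0 \<le> u \<Longrightarrow> model_map (s, pull_back s u) = (shift s, u)"
  by (simp add: model_map_pair exp_pull_back)

lemma pull_back_nonneg: "0 \<le> u \<Longrightarrow> 0 \<le> pull_back s u"
  using pull_back_arg_ge[of u s] unfolding pull_back_def by (intro ln_ge_zero) linarith

lemma pull_back_mem_X: "(shift s, u) \<in> X \<Longrightarrow> (s, pull_back s u) \<in> X"
  using model_map_mem_X_iff[of "(s, pull_back s u)"] model_map_mem_X_iff[of "(shift s, u)"]
  by (auto simp: model_map_pull_back pull_back_nonneg)

lemma pull_back_mono: "0 \<le> u \<Longrightarrow> u \<le> v \<Longrightarrow> pull_back s u \<le> pull_back s v"
  using exp_pull_back[of u s] exp_pull_back[of v s]
    exp_le_cancel_iff[of "pull_back s u" "pull_back s v"] by linarith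

lemma pull_back_forward: "pull_back s (exp t - 1 - 2 * pi * \<bar>real_of_int (s 1)\<bar>) = t"
  by (simp add: pull_back_def)

lemma continuous_on_pull_back: "0 \<le> a \<Longrightarrow> continuous_on {a..} (pull_back s)"
  unfolding pull_back_def
proof (intro continuous_intros ballI)
  fix u assume "0 \<le> a" "u \<in> {a..}"
  then show "u + 1 + 2 * pi * \<bar>real_of_int (s 1)\<bar> \<noteq> 0"
    using pull_back_arg_ge[of u s] unfolding atLeast_iff by linarith
qed

lemma filterlim_pull_back: "filterlim (pull_back s) at_top at_top"
  unfolding pull_back_def
  by (intro filterlim_compose[OF ln_at_top] filterlim_at_top_mono[OF filterlim_ident])
    (auto simp: add_nonneg_nonneg)

lemma continuous_on_T_iter: "continuous_on UNIV (\<lambda>t. T ((model_map ^^ n) (s, t)))"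
  by (induction n) (simp, simp only: T_model_map_Suc, intro continuous_intros)

context exp_parameter
begin

section \<open>Points whose whole orbit lies far to the right\<close>

text \<open>The quotient is an integer, so \<open>round\<close> only changes its type.\<close>

definition orbit_address :: "complex \<Rightarrow> address" where
  "orbit_address z n =
    round ((Im ((exp_map \<kappa> ^^ n) z) - Im (Ln ((exp_map \<kappa> ^^ Suc n) z - \<kappa>))) / (2 * pi))"

lemma shift_orbit_address: "shift (orbit_address z) = orbit_address (exp_map \<kappa> z)"
  unfolding shift_def orbit_address_def funpow_Suc_apply ..

lemma orbit_address_L: "L \<kappa> (orbit_address z 0) (exp_map \<kappa> z) = z"
proof -
  have "exp z = exp (Ln (exp z))" by simp
  then obtain n :: int where n: "z = Ln (exp z) + of_real (of_int (2 * n) * pi) * \<i>"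
    unfolding exp_eq[of z] by blast
  have "Im z - Im (Ln (exp z)) = 2 * pi * n"
    using arg_cong[OF n, of Im] by simp
  then have "orbit_address z 0 = n"
    by (simp add: orbit_address_def exp_map_def)
  then show ?thesis
    using n by (simp add: L_def exp_map_def mult_ac)
qed

lemma orbit_address_close: "\<bar>Im z - 2 * pi * orbit_address z 0\<bar> \<le> pi"
proof -
  have "Im z = Im (Ln (exp z)) + 2 * pi * orbit_address z 0"
    using arg_cong[OF orbit_address_L[of z], of Im] by (simp add: L_def exp_map_def)
  then show ?thesis
    using mpi_less_Im_Ln[of "exp z"] Im_Ln_le_pi[of "exp z"] by auto
qed

lemma dist_model_point:
  assumes "\<bar>Re z - t\<bar> \<le> 1"
  shows "norm (z - (of_real t + 2 * of_real pi * \<i> * of_int (orbit_address z 0))) \<le> pi + 2"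
proof -
  have "norm (z - (of_real t + 2 * of_real pi * \<i> * of_int (orbit_address z 0)))
    \<le> \<bar>Re z - t\<bar> + \<bar>Im z - 2 * pi * orbit_address z 0\<bar>"
    using cmod_le[of "z - (of_real t + 2 * of_real pi * \<i> * of_int (orbit_address z 0))"] by simp
  then show ?thesis using assms orbit_address_close[of z] by linarith
qed

text \<open>The potential is built backwards from time n by \<open>pull_back\<close>. Errors do not
  accumulate: by \<open>Re_Ln_near_model\<close> a logarithm taken within \<open>pi + 2\<close> of a
  model point has real-part error at most 1, whatever the previous error inside that disc.\<close>

lemma finite_shadowing:
  assumes "\<And>n. 4 * (K + pi + 3) \<le> Re ((exp_map \<kappa> ^^ n) z)"
  shows "\<exists>t. \<forall>m\<le>n. \<bar>Re ((exp_map \<kappa> ^^ m) z) - T ((model_map ^^ m) (orbit_address z, t))\<bar> \<le> 1"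
  using assms
proof (induction n arbitrary: z)
  case 0
  show ?case by (intro exI[of _ "Re z"]) simp
next
  case (Suc n)
  define w where "w = exp_map \<kappa> z"
  define s where "s = orbit_address z"
  have w: "4 * (K + pi + 3) \<le> Re ((exp_map \<kappa> ^^ m) w)" for m
    using Suc.prems[of "Suc m"] by (simp only: w_def funpow_Suc_apply)
  from Suc.IH[OF this] obtain u where
    u: "\<bar>Re ((exp_map \<kappa> ^^ m) w) - T ((model_map ^^ m) (shift s, u))\<bar> \<le> 1" if "m \<le> n" for m
    unfolding s_def w_def shift_orbit_address by blast
  have u0: "\<bar>Re w - u\<bar> \<le> 1" using u[of 0] by simp
  have pos: "0 < K + pi + 3" using K_gt_6 by (simp add: add_pos_pos)
  have Re_w: "4 * (K + pi + 3) \<le> Re w" using w[of 0] by simp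
  then have "4 * (K + pi + 3) \<le> u + 1" using u0 by linarith
  moreover have "1 \<le> 4 * (K + pi + 3)" using K_gt_6 pi_gt_zero unfolding distrib_left by linarith
  ultimately have u_nonneg: "0 \<le> u" by linarith
  have s1: "s 1 = orbit_address w 0"
    using fun_cong[OF shift_orbit_address[of z], of 0] by (simp add: shift_def s_def w_def)
  define t where "t = pull_back s u"
  have exp_t: "exp t = u + 1 + 2 * pi * \<bar>real_of_int (orbit_address w 0)\<bar>"
    using exp_pull_back[OF u_nonneg, of s] unfolding t_def s1 .
  have exp_t_ge: "4 * (K + pi + 3) \<le> exp t"
    using \<open>4 * (K + pi + 3) \<le> u + 1\<close> pull_back_arg_ge[of u s] exp_t unfolding s1 by linarith
  have "\<bar>ln (norm (w - \<kappa>)) - t\<bar> \<le> 1"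
    by (rule Re_Ln_near_model[OF u_nonneg exp_t exp_t_ge dist_model_point[OF u0]])
  then have z: "\<bar>Re z - t\<bar> \<le> 1" by (simp add: w_def exp_map_def)
  show ?case
  proof (intro exI[of _ t] allI impI)
    fix m assume "m \<le> Suc n"
    show "\<bar>Re ((exp_map \<kappa> ^^ m) z) - T ((model_map ^^ m) (orbit_address z, t))\<bar> \<le> 1"
    proof (cases m)
      case 0
      then show ?thesis using z by simp
    next
      case (Suc k)
      then show ?thesis
        using u[of k] \<open>m \<le> Suc n\<close> model_map_pull_back[OF u_nonneg, of s]
        by (simp only: w_def s_def t_def funpow_Suc_right comp_apply Suc_le_mono)
    qed
  qed
qed

text \<open>Compactness: the potentials that shadow up to time n form a decreasing sequence of
  nonempty compact sets.\<close>

lemma shadowing: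
  assumes "\<And>n. 4 * (K + pi + 3) \<le> Re ((exp_map \<kappa> ^^ n) z)"
  obtains t where "\<And>n. \<bar>Re ((exp_map \<kappa> ^^ n) z) - T ((model_map ^^ n) (orbit_address z, t))\<bar> \<le> 1"
proof -
  define S where "S n = {t. \<forall>m\<in>{..n}. \<bar>Re ((exp_map \<kappa> ^^ m) z) - T ((model_map ^^ m) (orbit_address z, t))\<bar> \<le> 1}" for n
  have cont: "continuous_on UNIV (\<lambda>t. \<bar>c - T ((model_map ^^ m) (orbit_address z, t))\<bar>)" for c m
    by (intro continuous_intros continuous_on_T_iter)
  have closed: "closed (S n)" for n
    unfolding S_def Ball_def
    by (intro closed_Collect_all closed_Collect_imp closed_Collect_le open_Collect_const cont continuous_on_const)
  have sub: "S n \<subseteq> {Re z - 1..Re z + 1}" for n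
  proof
    fix t assume "t \<in> S n"
    then have "\<bar>Re ((exp_map \<kappa> ^^ 0) z) - T ((model_map ^^ 0) (orbit_address z, t))\<bar> \<le> 1"
      unfolding S_def by blast
    then show "t \<in> {Re z - 1..Re z + 1}" by auto
  qed
  have "\<Inter> (range S) \<noteq> {}"
  proof (rule compact_nest)
    show "compact (S n)" for n
      using closed sub compact_Int_closed[OF compact_Icc closed] by (metis inf.absorb2)
    show "S n \<noteq> {}" for n
      using finite_shadowing[OF assms, of n] by (auto simp: S_def)
    show "S n \<subseteq> S m" if "m \<le> n" for m n
      using that by (auto simp: S_def)
  qed
  then obtain t where "\<And>n. t \<in> S n" by blast
  then show thesis by (intro that[of t]) (auto simp: S_def)
qed

text \<open>Both points arise from their n-th images by the same inverse branches, which contract by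
  1/2 on discs containing both orbits. The n-th images are at most two radii apart.\<close>

lemma g_lim_unique:
  assumes x: "x \<in> Y K" and near: "\<And>n. (exp_map \<kappa> ^^ n) z \<in> nbhd ((model_map ^^ n) x)"
    and address: "fst x = orbit_address z"
  shows "g_lim \<kappa> x = z"
proof -
  have "norm (g_lim \<kappa> x - z) \<le> norm (g_lim \<kappa> ((model_map ^^ n) x) - (exp_map \<kappa> ^^ n) z) / 2 ^ n" for n
    using assms
  proof (induction n arbitrary: x z)
    case (Suc n)
    let ?x = "model_map x" and ?z = "exp_map \<kappa> z"
    have F: "?x \<in> Y K" using model_map_mem_Y Suc.prems(1) .
    have fst: "fst ?x = orbit_address ?z"
      using Suc.prems(3) shift_orbit_address[of z] by (simp add: model_map_def split_beta)
    have near: "(exp_map \<kappa> ^^ m) ?z \<in> nbhd ((model_map ^^ m) ?x)" for m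
      using Suc.prems(2)[of "Suc m"] by (simp only: funpow_Suc_apply)
    have "g_lim \<kappa> x - z = L \<kappa> (fst x 0) (g_lim \<kappa> ?x) - L \<kappa> (fst x 0) ?z"
      using g_lim_eq_L[OF Suc.prems(1)] orbit_address_L[of z] Suc.prems(3) by simp
    then have "norm (g_lim \<kappa> x - z) \<le> norm (g_lim \<kappa> ?x - ?z) / 2"
      using L_contraction[OF Suc.prems(1) g_lim_mem_nbhd[OF F], of ?z] near[of 0] by simp
    also have "\<dots> \<le> norm (g_lim \<kappa> ((model_map ^^ n) ?x) - (exp_map \<kappa> ^^ n) ?z) / 2 ^ n / 2"
      by (intro divide_right_mono Suc.IH F near fst) simp
    finally show ?case by (simp add: funpow_Suc_apply mult_ac del: funpow.simps)
  qed simp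
  moreover have "norm (g_lim \<kappa> ((model_map ^^ n) x) - (exp_map \<kappa> ^^ n) z) \<le> 2 * (pi + 2)" for n
    using g_lim_mem_nbhd[OF model_map_iter_mem_Y[OF x], of n] near[of n]
      norm_triangle_ineq4[of "g_lim \<kappa> ((model_map ^^ n) x) - Z ((model_map ^^ n) x)" 
        "(exp_map \<kappa> ^^ n) z - Z ((model_map ^^ n) x)"]
    by (simp add: mem_nbhd_iff)
  then have "norm (g_lim \<kappa> ((model_map ^^ n) x) - (exp_map \<kappa> ^^ n) z) / 2 ^ n \<le> 2 * ((pi + 2) / 2 ^ n)" for n
    unfolding times_divide_eq_right by (intro divide_right_mono) auto
  ultimately have "norm (g_lim \<kappa> x - z) \<le> 2 * ((pi + 2) / 2 ^ n)" for n
    using order_trans by blast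
  then have "norm (g_lim \<kappa> x - z) \<le> 2 * 0"
    by (intro tendsto_lowerbound[OF tendsto_mult_left[OF error_tendsto_0]]) auto
  then show ?thesis by simp
qed

lemma g_lim_surj_far:
  assumes esc: "z \<in> escaping_set \<kappa>" and large: "\<And>n. 4 * (K + pi + 3) + Q K \<le> Re ((exp_map \<kappa> ^^ n) z)"
  shows "\<exists>x \<in> Y K \<inter> X. g_lim \<kappa> x = z"
proof -
  have "4 * (K + pi + 3) \<le> Re ((exp_map \<kappa> ^^ n) z)" for n
    using large[of n] Q_nonneg[of K] by linarith
  then obtain t where
    t: "\<And>n. \<bar>Re ((exp_map \<kappa> ^^ n) z) - T ((model_map ^^ n) (orbit_address z, t))\<bar> \<le> 1"
    using shadowing by blast
  define x where "x = (orbit_address z, t)"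
  \<comment> \<open>The surplus over \<open>Q K\<close> absorbs the shadowing error 1 and puts the
    model orbit in \<open>Y\<close>.\<close>
  have "1 \<le> 4 * (K + pi + 3)" using K_gt_6 pi_gt_zero unfolding distrib_left by linarith
  then have ge: "Q K \<le> T ((model_map ^^ n) x)" for n
    using large[of n] t[of n] unfolding x_def by linarith
  then have Y: "x \<in> Y K" by (simp add: mem_Y_iff)
  have "filterlim (\<lambda>n. T ((model_map ^^ n) x)) at_top sequentially"
  proof (rule filterlim_at_top_mono)
    show "filterlim (\<lambda>n. - 1 + Re ((exp_map \<kappa> ^^ n) z)) at_top sequentially"
      by (intro filterlim_tendsto_add_at_top[OF tendsto_const] Re_escaping_at_top esc)
    show "\<forall>\<^sub>F n in sequentially. - 1 + Re ((exp_map \<kappa> ^^ n) z) \<le> T ((model_map ^^ n) x)"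
      using t by (intro always_eventually allI) (smt (verit) x_def)
  qed
  then have X: "x \<in> X" using ge Q_nonneg[of K] by (auto simp: mem_X_iff intro: order_trans)
  have "g_lim \<kappa> x = z"
  proof (rule g_lim_unique[OF Y])
    show "fst x = orbit_address z" by (simp add: x_def)
    have addr: "orbit_address z n = orbit_address ((exp_map \<kappa> ^^ n) z) 0" for n
      by (simp add: orbit_address_def add.commute flip: funpow_add comp_apply[of "_ ^^ _"])
    show "(exp_map \<kappa> ^^ n) z \<in> nbhd ((model_map ^^ n) x)" for n
      using dist_model_point[OF t[of n]] addr[of n] 
      by (simp add: mem_nbhd_iff Z_eq fst_model_map_iter x_def)
  qed
  then show ?thesis using X Y by blast
qed

end

text \<open>Exponentials are peeled off one at a time: at each level the two curves are logarithms
  of the same curve, so they differ by a constant, which vanishes because they agree for large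
  potentials.\<close>

lemma iterated_lifts_equal:
  fixes a :: real
  assumes "continuous_on {a..} h" "continuous_on {a..} h'"
    and "\<And>u. a \<le> u \<Longrightarrow> (exp_map \<kappa> ^^ n) (h u) = (exp_map \<kappa> ^^ n) (h' u)"
    and "\<forall>\<^sub>F u in at_top. h u = h' u" "a \<le> u"
  shows "h u = h' u"
  using assms
proof (induction n arbitrary: h h' u)
  case (Suc n)
  have "exp_map \<kappa> (h v) = exp_map \<kappa> (h' v)" if "a \<le> v" for v
  proof (rule Suc.IH[OF _ _ _ _ that])
    show "continuous_on {a..} (\<lambda>v. exp_map \<kappa> (h v))" "continuous_on {a..} (\<lambda>v. exp_map \<kappa> (h' v))"
      unfolding exp_map_def by (intro continuous_intros Suc.prems)+
    show "(exp_map \<kappa> ^^ n) (exp_map \<kappa> (h v)) = (exp_map \<kappa> ^^ n) (exp_map \<kappa> (h' v))" if "a \<le> v" for v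
      using Suc.prems(3)[OF that] by (simp only: funpow_Suc_apply)
    show "\<forall>\<^sub>F v in at_top. exp_map \<kappa> (h v) = exp_map \<kappa> (h' v)"
      using Suc.prems(4) by eventually_elim simp
  qed
  then have exp_eq: "exp (h v) = exp (h' v)" if "v \<in> {a..}" for v
    using that by (simp add: exp_map_def)
  obtain v where v: "a \<le> v" "h v = h' v"
    using eventually_conj[OF eventually_ge_at_top[of a] Suc.prems(4)]
    unfolding eventually_at_top_linorder by blast
  have "h u - h' u = h v - h' v"
    using Suc.prems(1,2,5) v(1) exp_eq
    by (intro logarithms_differ_by_constant[of "{a..}" h h']) auto
  then show ?case using v by simp
qed simp

context exp_parameter
begin

section \<open>Extension to the whole model by lifting along rays\<close>

definition far :: "(address \<times> real) set" where
  "far = Y K \<inter> X"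

lemma model_map_iter_mem_far: "x \<in> far \<Longrightarrow> (model_map ^^ n) x \<in> far"
  by (simp add: far_def model_map_iter_mem_X model_map_iter_mem_Y)

lemma far_upward_closed: "(s, t) \<in> far \<Longrightarrow> t \<le> u \<Longrightarrow> (s, u) \<in> far"
  using X_upward_closed[of s t u] Y_upward_closed[of s t K u] by (simp add: far_def)

lemma eventually_far:
  assumes "(s, t) \<in> X"
  shows "\<forall>\<^sub>F u in at_top. (s, u) \<in> far"
  using eventually_ge_at_top[of "t + Q K"]
proof eventually_elim
  case (elim u)
  have "(s, u) \<in> Y K" by (rule Y_if_Q_greater[OF subsetD[OF X_subset_Xbar assms] elim])
  moreover have "(s, u) \<in> X" using X_upward_closed[OF assms, of u] elim Q_nonneg[of K] by linarith
  ultimately show ?case by (simp add: far_def)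
qed

lemma X_reaches_far:
  assumes "x \<in> X"
  obtains N where "\<And>n. N \<le> n \<Longrightarrow> (model_map ^^ n) x \<in> far"
proof -
  obtain N where "\<And>n. N \<le> n \<Longrightarrow> (model_map ^^ n) x \<in> Y K"
    using X_eventually_Y[OF assms, of K] by blast
  then show thesis by (intro that[of N]) (simp add: far_def model_map_iter_mem_X[OF assms])
qed

text \<open>The extension along the ray of \<open>s\<close> solves \<open>E\<^sup>n \<circ> h = g \<circ> F\<^sup>n\<close>, where \<open>g\<close> is the limit
  on \<open>Y\<close>; the asymptotic condition selects the branch, so that \<open>h\<close> does not depend on \<open>n\<close>.\<close>

definition is_lift :: "address \<Rightarrow> real \<Rightarrow> (real \<Rightarrow> complex) \<Rightarrow> bool" where
  "is_lift s t h \<longleftrightarrow> continuous_on {t..} h \<and>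
     (\<exists>n. \<forall>u\<ge>t. (model_map ^^ n) (s, u) \<in> far \<and>
        (exp_map \<kappa> ^^ n) (h u) = g_lim \<kappa> ((model_map ^^ n) (s, u))) \<and>
     (\<forall>\<^sub>F u in at_top. h u = g_lim \<kappa> (s, u))"

lemma is_lift_restrict: "is_lift s t h \<Longrightarrow> t \<le> u \<Longrightarrow> is_lift s u h"
  unfolding is_lift_def by (meson atLeast_subset_iff continuous_on_subset order_trans)

lemma is_lift_cong:
  assumes "is_lift s t h" "\<And>u. t \<le> u \<Longrightarrow> h' u = h u"
  shows "is_lift s t h'"
  unfolding is_lift_def
proof (intro conjI)
  show "continuous_on {t..} h'"
    using assms continuous_on_cong[of "{t..}" "{t..}" h' h] by (auto simp: is_lift_def)
  show "\<exists>n. \<forall>u\<ge>t. (model_map ^^ n) (s, u) \<in> far \<and>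
        (exp_map \<kappa> ^^ n) (h' u) = g_lim \<kappa> ((model_map ^^ n) (s, u))"
    using assms by (auto simp: is_lift_def)
  have "\<forall>\<^sub>F u in at_top. h u = g_lim \<kappa> (s, u)" using assms by (simp add: is_lift_def)
  then show "\<forall>\<^sub>F u in at_top. h' u = g_lim \<kappa> (s, u)"
    using eventually_ge_at_top[of t] by eventually_elim (simp add: assms)
qed

text \<open>The conjugacy on \<open>far\<close> carries the relation to all later times, so lifts
  defined with different exponents can be compared at a common one.\<close>

lemma is_lift_all_large:
  assumes "is_lift s t h"
  shows "\<exists>N. \<forall>n\<ge>N. \<forall>u\<ge>t. (model_map ^^ n) (s, u) \<in> far \<and>
    (exp_map \<kappa> ^^ n) (h u) = g_lim \<kappa> ((model_map ^^ n) (s, u))"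
proof -
  obtain N where N: "(model_map ^^ N) (s, u) \<in> far"
    "(exp_map \<kappa> ^^ N) (h u) = g_lim \<kappa> ((model_map ^^ N) (s, u))" if "t \<le> u" for u
    using assms unfolding is_lift_def by blast
  have split: "(f ^^ n) v = (f ^^ (n - N)) ((f ^^ N) v)" if "N \<le> n" for f :: "'b \<Rightarrow> 'b" and n v
    using funpow_add[of "n - N" N f] that by simp
  show ?thesis
  proof (intro exI[of _ N] allI impI conjI)
    fix n u assume "N \<le> n" "t \<le> u"
    note far = N(1)[OF \<open>t \<le> u\<close>]
    show "(model_map ^^ n) (s, u) \<in> far"
      unfolding split[OF \<open>N \<le> n\<close>] by (rule model_map_iter_mem_far[OF far])
    show "(exp_map \<kappa> ^^ n) (h u) = g_lim \<kappa> ((model_map ^^ n) (s, u))"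
      unfolding split[OF \<open>N \<le> n\<close>] N(2)[OF \<open>t \<le> u\<close>]
      by (rule exp_map_iter_g_lim) (use far in \<open>simp add: far_def\<close>)
  qed
qed

lemma is_lift_escaping:
  assumes "is_lift s t h" "t \<le> u"
  shows "h u \<in> escaping_set \<kappa>"
proof -
  obtain n where "(model_map ^^ n) (s, u) \<in> far"
    "(exp_map \<kappa> ^^ n) (h u) = g_lim \<kappa> ((model_map ^^ n) (s, u))"
    using assms unfolding is_lift_def by blast
  then have "(exp_map \<kappa> ^^ n) (h u) \<in> escaping_set \<kappa>" using g_lim_escaping by (simp add: far_def)
  then show ?thesis by (simp add: exp_map_iter_escaping_iff)
qed

lemma is_lift_unique:
  assumes lift: "is_lift s t h" and lift': "is_lift s t h'" and "t \<le> u"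
  shows "h u = h' u"
proof -
  obtain N where N: "(exp_map \<kappa> ^^ n) (h u) = g_lim \<kappa> ((model_map ^^ n) (s, u))"
    if "N \<le> n" "t \<le> u" for n u
    using is_lift_all_large[OF lift] by blast
  obtain N' where N': "(exp_map \<kappa> ^^ n) (h' u) = g_lim \<kappa> ((model_map ^^ n) (s, u))"
    if "N' \<le> n" "t \<le> u" for n u
    using is_lift_all_large[OF lift'] by blast
  show ?thesis
  proof (rule iterated_lifts_equal[where n = "max N N'", OF _ _ _ _ \<open>t \<le> u\<close>])
    show "continuous_on {t..} h" "continuous_on {t..} h'"
      using lift lift' by (simp_all add: is_lift_def)
    show "(exp_map \<kappa> ^^ max N N') (h u) = (exp_map \<kappa> ^^ max N N') (h' u)" if "t \<le> u" for u
      using N[of "max N N'" u] N'[of "max N N'" u] that by simp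
    have "\<forall>\<^sub>F u in at_top. h u = g_lim \<kappa> (s, u)" "\<forall>\<^sub>F u in at_top. h' u = g_lim \<kappa> (s, u)"
      using lift lift' by (simp_all add: is_lift_def)
    then show "\<forall>\<^sub>F u in at_top. h u = h' u" by eventually_elim simp
  qed
qed

lemma is_lift_g_lim:
  assumes "(s, t) \<in> far"
  shows "is_lift s t (\<lambda>u. g_lim \<kappa> (s, u))"
  unfolding is_lift_def
proof (intro conjI)
  show "continuous_on {t..} (\<lambda>u. g_lim \<kappa> (s, u))"
    by (rule continuous_on_subset[OF continuous_on_g_lim]) (use far_upward_closed[OF assms] in \<open>auto simp: far_def\<close>)
  show "\<exists>n. \<forall>u\<ge>t. (model_map ^^ n) (s, u) \<in> far \<and>
        (exp_map \<kappa> ^^ n) (g_lim \<kappa> (s, u)) = g_lim \<kappa> ((model_map ^^ n) (s, u))"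
    using far_upward_closed[OF assms] by (intro exI[of _ 0]) simp
qed simp

end

section \<open>Existence of lifts and the extended bijection\<close>

locale nonescaping_parameter = exp_parameter +
  assumes nonescaping: "nonescaping \<kappa>"
begin

text \<open>A lift on the shifted ray is transported back by a continuous logarithm of
  \<open>h - \<kappa>\<close>, normalized to agree with \<open>g_lim\<close> at large
  potentials.\<close>

lemma is_lift_exists_step:
  assumes X: "(s, t) \<in> X" and lift: "is_lift (shift s) (T (model_map (s, t))) h"
  shows "\<exists>h. is_lift s t h"
proof -
  define \<phi> where "\<phi> u = exp u - 1 - 2 * pi * \<bar>real_of_int (s 1)\<bar>" for u
  have \<phi>: "model_map (s, u) = (shift s, \<phi> u)" for u by (simp add: model_map_pair \<phi>_def)
  have lift: "is_lift (shift s) (\<phi> t) h" using lift by (simp add: \<phi>)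
  have \<phi>_mono: "\<phi> t \<le> \<phi> u" if "t \<le> u" for u using that by (simp add: \<phi>_def)
  have "filterlim (\<lambda>u. - (1 + 2 * pi * \<bar>real_of_int (s 1)\<bar>) + exp u) at_top at_top"
    by (intro filterlim_tendsto_add_at_top[OF tendsto_const exp_at_top])
  then have \<phi>_top: "filterlim \<phi> at_top at_top"
    by (simp add: \<phi>_def[abs_def] algebra_simps)
  have cont: "continuous_on {t..} (\<lambda>u. h (\<phi> u) - \<kappa>)"
  proof (rule continuous_on_diff[OF continuous_on_compose2[of "{\<phi> t..}" h]])
    show "continuous_on {\<phi> t..} h" using lift by (simp add: is_lift_def)
    show "continuous_on {t..} \<phi>" unfolding \<phi>_def by (intro continuous_intros)
  qed (use \<phi>_mono in auto)
  have "contractible {t..}" by (rule convex_imp_contractible) simp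
  \<comment> \<open>Here nonescaping of \<kappa> enters: \<open>h\<close> takes only escaping values
    and so never meets \<kappa>.\<close>
  moreover have "h (\<phi> u) - \<kappa> \<noteq> 0" if "u \<in> {t..}" for u
    using is_lift_escaping[OF lift \<phi>_mono] nonescaping that by (force simp: nonescaping_def)
  ultimately obtain l where l: "continuous_on {t..} l" "\<And>u. u \<in> {t..} \<Longrightarrow> h (\<phi> u) - \<kappa> = exp (l u)"
    using continuous_logarithm_on_contractible[OF cont] by blast
  have "\<forall>\<^sub>F v in at_top. h v = g_lim \<kappa> (shift s, v)"
    using lift by (simp add: is_lift_def)
  then have "\<forall>\<^sub>F u in at_top. h (\<phi> u) = g_lim \<kappa> (model_map (s, u))"
    unfolding \<phi> using \<phi>_top by (rule eventually_compose_filterlim)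
  then have "\<forall>\<^sub>F u in at_top. t \<le> u \<and> (s, u) \<in> far \<and> h (\<phi> u) = g_lim \<kappa> (model_map (s, u))"
    by (intro eventually_conj eventually_ge_at_top eventually_far[OF X])
  then obtain a where a: "t \<le> u" "(s, u) \<in> far" "h (\<phi> u) = g_lim \<kappa> (model_map (s, u))" if "a \<le> u" for u
    unfolding eventually_at_top_linorder by blast
  \<comment> \<open>The period of exp by which the chosen logarithm misses the right branch; adding
    it leaves the exponential unchanged.\<close>
  define c where "c = g_lim \<kappa> (s, a) - l a"
  have exp_eq: "exp (g_lim \<kappa> (s, u)) = exp (l u)" if "u \<in> {a..}" for u
  proof -
    have u: "a \<le> u" using that by simp
    then have "exp_map \<kappa> (g_lim \<kappa> (s, u)) = h (\<phi> u)"
      using a[OF u] exp_map_g_lim[of "(s, u)"] by (simp add: far_def)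
    then show ?thesis
      using l(2)[of u] a(1)[OF u] unfolding exp_map_def by (metis add_diff_cancel_right' atLeast_iff)
  qed
  have const: "g_lim \<kappa> (s, u) - l u = c" if "a \<le> u" for u
    unfolding c_def
  proof (rule logarithms_differ_by_constant[of "{a..}"])
    show "continuous_on {a..} (\<lambda>u. g_lim \<kappa> (s, u))"
      using is_lift_g_lim[of s a] a(2) by (simp add: is_lift_def)
    show "continuous_on {a..} l" by (rule continuous_on_subset[OF l(1)]) (use a(1) in auto)
  qed (use exp_eq that in auto)
  have exp_c: "exp c = 1" using exp_eq[of a] by (simp add: c_def exp_diff)
  have forward: "exp_map \<kappa> (l u + c) = h (\<phi> u)" if "t \<le> u" for u
    using l(2)[of u] that by (simp add: exp_map_def exp_add exp_c algebra_simps)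
  have "is_lift s t (\<lambda>u. l u + c)"
    unfolding is_lift_def
  proof (intro conjI)
    show "continuous_on {t..} (\<lambda>u. l u + c)" by (intro continuous_intros l)
    obtain n where n: "(model_map ^^ n) (shift s, v) \<in> far"
      "(exp_map \<kappa> ^^ n) (h v) = g_lim \<kappa> ((model_map ^^ n) (shift s, v))" if "\<phi> t \<le> v" for v
      using lift unfolding is_lift_def by blast
    show "\<exists>n. \<forall>u\<ge>t. (model_map ^^ n) (s, u) \<in> far \<and>
        (exp_map \<kappa> ^^ n) (l u + c) = g_lim \<kappa> ((model_map ^^ n) (s, u))"
    proof (intro exI[of _ "Suc n"] allI impI)
      fix u assume "t \<le> u"
      then show "(model_map ^^ Suc n) (s, u) \<in> far \<and>
        (exp_map \<kappa> ^^ Suc n) (l u + c) = g_lim \<kappa> ((model_map ^^ Suc n) (s, u))"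
        using n[OF \<phi>_mono] unfolding funpow_Suc_right comp_apply by (simp add: \<phi> forward)
    qed
    show "\<forall>\<^sub>F u in at_top. l u + c = g_lim \<kappa> (s, u)"
      using eventually_ge_at_top[of a] by eventually_elim (use const in \<open>simp add: algebra_simps\<close>)
  qed
  then show ?thesis by blast
qed

lemma is_lift_exists:
  assumes "(s, t) \<in> X"
  shows "\<exists>h. is_lift s t h"
proof -
  obtain n where "(model_map ^^ n) (s, t) \<in> far"
    using X_reaches_far[OF assms] by blast
  with assms show ?thesis
  proof (induction n arbitrary: s t)
    case 0
    then show ?case using is_lift_g_lim by auto
  next
    case (Suc n)
    have pair: "model_map (s, t) = (shift s, T (model_map (s, t)))"
      by (simp add: model_map_pair)
    have "(shift s, T (model_map (s, t))) \<in> X" "(model_map ^^ n) (shift s, T (model_map (s, t))) \<in> far"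
      using Suc.prems model_map_mem_X unfolding pair[symmetric] funpow_Suc_apply by blast+
    then have "\<exists>h. is_lift (shift s) (T (model_map (s, t))) h" by (rule Suc.IH)
    then show ?case using is_lift_exists_step Suc.prems(1) by blast
  qed
qed

text \<open>The chosen lift may vary with the point; by uniqueness of lifts the values still fit
  together along each ray.\<close>

definition extension :: "address \<times> real \<Rightarrow> complex" where
  "extension x = (SOME h. is_lift (fst x) (snd x) h) (snd x)"

lemma extension_eq:
  assumes "is_lift s t h" "t \<le> u"
  shows "extension (s, u) = h u"
proof -
  have "is_lift s u h" using is_lift_restrict assms .
  then show ?thesis
    using is_lift_unique[OF someI[of "is_lift s u" h], of h u] by (simp add: extension_def)
qed

lemma is_lift_extension:
  assumes "(s, t) \<in> X"
  shows "is_lift s t (\<lambda>u. extension (s, u))"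
  using is_lift_exists[OF assms] is_lift_cong extension_eq by metis

lemma extension_far: "x \<in> far \<Longrightarrow> extension x = g_lim \<kappa> x"
  using extension_eq[OF is_lift_g_lim[of "fst x" "snd x"], of "snd x"] by simp

lemma extension_escaping: "x \<in> X \<Longrightarrow> extension x \<in> escaping_set \<kappa>"
  using is_lift_escaping[OF is_lift_extension[of "fst x" "snd x"], of "snd x"] by simp

lemma continuous_on_extension: "(s, t) \<in> X \<Longrightarrow> continuous_on {t..} (\<lambda>u. extension (s, u))"
  using is_lift_extension unfolding is_lift_def by blast

text \<open>The image under \<open>exp_map\<close> of the lift along \<open>s\<close>,
  reparametrized by \<open>pull_back\<close>, is a lift along the shifted ray; uniqueness identifies
  the two.\<close>

lemma extension_model_map:
  assumes "x \<in> X"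
  shows "extension (model_map x) = exp_map \<kappa> (extension x)"
proof -
  obtain s t where x: "x = (s, t)" by (cases x)
  then have X: "(s, t) \<in> X" using assms by simp
  define t' where "t' = T (model_map (s, t))"
  have F: "model_map (s, t) = (shift s, t')" by (simp add: t'_def model_map_pair)
  have t': "0 \<le> t'" using model_map_mem_X[OF X] model_map_mem_X_iff[of "(shift s, t')"] by (simp add: F)
  have pb_t': "pull_back s t' = t" by (simp add: t'_def model_map_pair pull_back_forward[simplified])
  have pb: "t \<le> pull_back s v" "model_map (s, pull_back s v) = (shift s, v)" if "t' \<le> v" for v
    using pull_back_mono[OF t' that, of s] model_map_pull_back[of v s] t' that by (simp_all add: pb_t')
  have "is_lift (shift s) t' (\<lambda>v. exp_map \<kappa> (extension (s, pull_back s v)))"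
    unfolding is_lift_def
  proof (intro conjI)
    have "continuous_on {t'..} (\<lambda>v. extension (s, pull_back s v))"
      by (rule continuous_on_compose2[OF continuous_on_extension[OF X] continuous_on_pull_back[OF t']])
        (use pb in auto)
    then show "continuous_on {t'..} (\<lambda>v. exp_map \<kappa> (extension (s, pull_back s v)))"
      unfolding exp_map_def by (intro continuous_intros)
    obtain N where N: "(model_map ^^ n) (s, u) \<in> far"
      "(exp_map \<kappa> ^^ n) (extension (s, u)) = g_lim \<kappa> ((model_map ^^ n) (s, u))"
      if "N \<le> n" "t \<le> u" for n u
      using is_lift_all_large[OF is_lift_extension[OF X]] by blast
    show "\<exists>n. \<forall>v\<ge>t'. (model_map ^^ n) (shift s, v) \<in> far \<and>
      (exp_map \<kappa> ^^ n) (exp_map \<kappa> (extension (s, pull_back s v))) = g_lim \<kappa> ((model_map ^^ n) (shift s, v))"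
      using N[of "Suc N", OF _ pb(1)] pb(2) unfolding funpow_Suc_right comp_apply by (intro exI[of _ N]) simp
    have "\<forall>\<^sub>F u in at_top. (s, u) \<in> far \<and> extension (s, u) = g_lim \<kappa> (s, u)"
      using eventually_far[OF X] by eventually_elim (simp add: extension_far)
    then have "\<forall>\<^sub>F v in at_top. (s, pull_back s v) \<in> far \<and>
        extension (s, pull_back s v) = g_lim \<kappa> (s, pull_back s v)"
      using filterlim_pull_back by (rule eventually_compose_filterlim)
    then show "\<forall>\<^sub>F v in at_top. exp_map \<kappa> (extension (s, pull_back s v)) = g_lim \<kappa> (shift s, v)"
      using eventually_ge_at_top[of t']
      by eventually_elim (metis IntD1 exp_map_g_lim far_def pb(2))
  qed
  from extension_eq[OF this, of t'] show ?thesis by (simp add: x F pb_t')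
qed

text \<open>Both rays are logarithms of the same curve, so their difference is constant and can be
  read off for large potentials, where the principal branch applies.\<close>

lemma extension_first_entry:
  assumes X: "(s, t) \<in> X" "(s', t) \<in> X" and shift: "shift s = shift s'"
  shows "extension (s, t) - extension (s', t) = 2 * of_real pi * \<i> * of_int (s 0 - s' 0)"
proof -
  have "s 1 = s' 1" using fun_cong[OF shift, of 0] by (simp add: shift_def)
  then have eq: "model_map (s, u) = model_map (s', u)" for u by (simp add: model_map_pair shift)
  have "\<forall>\<^sub>F u in at_top. t \<le> u \<and> (s, u) \<in> far \<and> (s', u) \<in> far"
    by (intro eventually_conj eventually_ge_at_top eventually_far[OF X(1)] eventually_far[OF X(2)])
  then obtain u where u: "t \<le> u" "(s, u) \<in> far" "(s', u) \<in> far"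
    using eventually_happens'[OF trivial_limit_at_top_linorder] by blast
  have "extension (s, t) - extension (s', t) = extension (s, u) - extension (s', u)"
  proof (rule logarithms_differ_by_constant[of "{t..}"])
    fix v assume "v \<in> {t..}"
    then show "exp (extension (s, v)) = exp (extension (s', v))"
      using extension_model_map[of "(s, v)"] extension_model_map[of "(s', v)"] eq[of v]
        X_upward_closed[OF X(1), of v] X_upward_closed[OF X(2), of v] by (simp add: exp_map_def)
  qed (use u in \<open>auto intro: continuous_on_extension[OF X(1)] continuous_on_extension[OF X(2)]\<close>)
  also have "\<dots> = g_lim \<kappa> (s, u) - g_lim \<kappa> (s', u)"
    using u by (simp add: extension_far)
  also have "\<dots> = 2 * of_real pi * \<i> * of_int (s 0 - s' 0)"
    using u g_lim_eq_L[of "(s, u)"] g_lim_eq_L[of "(s', u)"] eq[of u]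
    by (simp add: far_def L_def algebra_simps)
  finally show ?thesis .
qed

text \<open>Induction from a time at which both orbits are in \<open>far\<close>. If the images
  under \<open>model_map\<close> agree, then so do all entries but the first, hence the potentials;
  the first entries agree because different ones shift the value by a nonzero period.\<close>

lemma inj_on_extension: "inj_on extension X"
proof (rule inj_onI)
  fix x y assume x: "x \<in> X" and y: "y \<in> X" and eq: "extension x = extension y"
  obtain N where N: "\<And>n. N \<le> n \<Longrightarrow> (model_map ^^ n) x \<in> far" using X_reaches_far[OF x] by blast
  obtain M where M: "\<And>n. M \<le> n \<Longrightarrow> (model_map ^^ n) y \<in> far" using X_reaches_far[OF y] by blast
  have "(model_map ^^ max N M) x \<in> far" "(model_map ^^ max N M) y \<in> far" using N M by simp_all
  then have "\<exists>n. (model_map ^^ n) x \<in> far \<and> (model_map ^^ n) y \<in> far" by blast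
  then obtain n where "(model_map ^^ n) x \<in> far" "(model_map ^^ n) y \<in> far" by blast
  with x y eq show "x = y"
  proof (induction n arbitrary: x y)
    case 0
    then show ?case using inj_on_g_lim by (auto simp: extension_far far_def dest: inj_onD)
  next
    case (Suc n)
    have "model_map x = model_map y"
    proof (rule Suc.IH)
      show "extension (model_map x) = extension (model_map y)"
        using Suc.prems by (simp add: extension_model_map)
      show "(model_map ^^ n) (model_map x) \<in> far" "(model_map ^^ n) (model_map y) \<in> far"
        using Suc.prems(4,5) by (simp_all only: funpow_Suc_apply)
    qed (use Suc.prems model_map_mem_X in auto)
    moreover obtain s t s' t' where xy: "x = (s, t)" "y = (s', t')" by (metis prod.exhaust)
    ultimately have shift: "shift s = shift s'" and exp: "exp t - 2 * pi * \<bar>real_of_int (s 1)\<bar> = exp t' - 2 * pi * \<bar>real_of_int (s' 1)\<bar>"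
      by (simp_all add: model_map_pair)
    have "s (Suc m) = s' (Suc m)" for m using fun_cong[OF shift, of m] by (simp add: shift_def)
    with exp have "t = t'" by simp
    with extension_first_entry[of s t s'] shift Suc.prems(1-3) have "s 0 = s' 0"
      by (simp add: xy)
    with \<open>\<And>m. s (Suc m) = s' (Suc m)\<close> have "s = s'" by (metis ext not0_implies_Suc)
    then show ?case using \<open>t = t'\<close> by (simp add: xy)
  qed
qed

text \<open>A far iterate of z is reached by shadowing. One then goes back a step at a time,
  choosing the first entry to hit the right logarithm.\<close>

lemma extension_surj:
  assumes "z \<in> escaping_set \<kappa>"
  shows "z \<in> extension ` X"
proof -
  obtain N where N: "\<And>n. 4 * (K + pi + 3) + Q K \<le> Re ((exp_map \<kappa> ^^ (n + N)) z)"
    using escaping_large_orbit[OF assms, of "4 * (K + pi + 3) + Q K"] by blast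
  have "\<exists>x \<in> Y K \<inter> X. g_lim \<kappa> x = (exp_map \<kappa> ^^ N) z"
    using N assms by (intro g_lim_surj_far) (simp_all add: exp_map_iter_escaping_iff funpow_add)
  then have "(exp_map \<kappa> ^^ N) z \<in> extension ` X"
    by (metis IntD2 extension_far far_def imageI)
  then show ?thesis
  proof (induction N arbitrary: z)
    case (Suc N)
    from Suc.IH[of "exp_map \<kappa> z"] Suc.prems have "exp_map \<kappa> z \<in> extension ` X"
      by (simp only: funpow_Suc_apply)
    then obtain r u where r: "(r, u) \<in> X" "extension (r, u) = exp_map \<kappa> z" by auto
    \<comment> \<open>All addresses whose shift is \<open>r\<close>. One potential \<open>t\<close>
      serves every \<open>k\<close>, since \<open>pull_back\<close> ignores the first entry.\<close>
    define a where "a k = case_nat k r" for k :: int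
    have shift_a: "shift (a k) = r" for k by (simp add: shift_def a_def)
    define t where "t = pull_back (a 0) u"
    have pull_back_a: "pull_back (a k) u = t" for k by (simp add: t_def pull_back_def a_def)
    have X: "(a k, t) \<in> X" for k using pull_back_mem_X[of "a k" u] r(1) by (simp add: shift_a pull_back_a)
    have u: "0 \<le> u" using r(1) model_map_mem_X_iff[of "(r, u)"] by simp
    have F: "model_map (a k, t) = (r, u)" for k
      using model_map_pull_back[OF u, of "a k"] by (simp add: shift_a pull_back_a)
    have "exp z = exp (extension (a 0, t))"
      using extension_model_map[OF X[of 0]] r(2) by (simp add: F exp_map_def)
    then obtain k :: int where k: "z = extension (a 0, t) + of_real (of_int (2 * k) * pi) * \<i>"
      unfolding exp_eq by blast
    have "extension (a k, t) - extension (a 0, t) = 2 * of_real pi * \<i> * of_int k"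
      using extension_first_entry[OF X X, of k 0] shift_a by (simp add: a_def)
    then have "extension (a k, t) = z" using k by (simp add: algebra_simps)
    then show ?case using X by blast
  qed simp
qed

lemma continuous_on_extension_ray: "continuous_on {t. (s, t) \<in> X} (\<lambda>t. extension (s, t))"
  unfolding continuous_on_eq_continuous_within
proof
  fix t assume t: "t \<in> {t. (s, t) \<in> X}"
  show "continuous (at t within {t. (s, t) \<in> X}) (\<lambda>t. extension (s, t))"
  \<comment> \<open>Continuity is known only on half-lines starting in \<open>X\<close>: either t is
    interior to one, or it is the least escaping potential.\<close>
  proof (cases "\<exists>t'<t. (s, t') \<in> X")
    case True
    then obtain t' where t': "t' < t" "(s, t') \<in> X" by blast
    have "continuous_on {t'<..} (\<lambda>t. extension (s, t))"
      by (rule continuous_on_subset[OF continuous_on_extension[OF t'(2)]]) auto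
    then have "isCont (\<lambda>t. extension (s, t)) t"
      using t'(1) by (simp add: continuous_on_eq_continuous_at)
    then show ?thesis by (rule continuous_at_imp_continuous_at_within)
  next
    case False
    then have "{t. (s, t) \<in> X} = {t..}" using t X_upward_closed by force
    moreover have "(s, t) \<in> X" using t by simp
    ultimately show ?thesis
      using continuous_on_extension[of s t] unfolding continuous_on_eq_continuous_within by simp
  qed
qed

lemma is_g_frak_extension: "is_g_frak \<kappa> K extension"
  unfolding is_g_frak_def bij_betw_def
  using extension_far extension_model_map continuous_on_extension_ray inj_on_extension
    extension_escaping extension_surj
  by (auto simp: far_def)

end

lemma g_frak_properties:
  assumes "nonescaping \<kappa>"
  shows "bij_betw (g_frak \<kappa>) X (escaping_set \<kappa>)"
    and "\<And>x. x \<in> X \<Longrightarrow> g_frak \<kappa> (model_map x) = exp_map \<kappa> (g_frak \<kappa> x)"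
proof -
  interpret nonescaping_parameter \<kappa> "2 * pi + 7 + norm \<kappa>"
    by unfold_locales (use assms pi_gt_zero norm_ge_zero[of \<kappa>] in linarith)+
  have "\<exists>G K. K > 2 * pi + 6 \<and> norm \<kappa> \<le> K \<and> is_g_frak \<kappa> K G"
    using is_g_frak_extension K_gt norm_le_K by blast
  from someI_ex[OF this] have "\<exists>K. is_g_frak \<kappa> K (g_frak \<kappa>)"
    unfolding g_frak_def by blast
  then show "bij_betw (g_frak \<kappa>) X (escaping_set \<kappa>)"
    and "\<And>x. x \<in> X \<Longrightarrow> g_frak \<kappa> (model_map x) = exp_map \<kappa> (g_frak \<kappa> x)"
    by (auto simp: is_g_frak_def)
qed

section \<open>Limit sets of rays\<close>

lemma limit_set_iff:
  "p \<in> limit_set \<kappa> s \<longleftrightarrow> (\<forall>t>0. \<forall>V. openin riemann_sphere V \<and> p \<in> V \<longrightarrow>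
     (\<exists>u. 0 < u \<and> u < t \<and> Some (ray \<kappa> s u) \<in> V))"
proof -
  have "p \<in> topspace riemann_sphere"
    by (cases p) (auto simp: riemann_sphere_def)
  then have "p \<in> riemann_sphere closure_of (Some ` ray \<kappa> s ` {0<..<t}) \<longleftrightarrow>
    (\<forall>V. openin riemann_sphere V \<and> p \<in> V \<longrightarrow> (\<exists>u. 0 < u \<and> u < t \<and> Some (ray \<kappa> s u) \<in> V))" for t
    unfolding in_closure_of by force
  then show ?thesis unfolding limit_set_def by auto
qed

lemma openin_riemann_sphere_ball: "openin riemann_sphere (Some ` ball p e)"
  by (simp add: riemann_sphere_def)

lemma limit_set_finite_point:
  assumes "Some p \<in> limit_set \<kappa> s" "0 < t" "0 < e"
  obtains u where "0 < u" "u < t" "norm (ray \<kappa> s u - p) < e"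
proof -
  have "\<exists>u. 0 < u \<and> u < t \<and> Some (ray \<kappa> s u) \<in> Some ` ball p e"
    using assms openin_riemann_sphere_ball[of p e] unfolding limit_set_iff by (metis centre_in_ball imageI)
  then show thesis using that by (auto simp: dist_norm norm_minus_commute)
qed

lemma not_in_limit_set:
  assumes "Some p \<notin> limit_set \<kappa> s"
  obtains t e where "0 < t" "0 < e" "\<And>u. 0 < u \<Longrightarrow> u < t \<Longrightarrow> e \<le> norm (ray \<kappa> s u - p)"
proof -
  obtain t V where t: "0 < t" "openin riemann_sphere V" "Some p \<in> V"
    "\<And>u. 0 < u \<Longrightarrow> u < t \<Longrightarrow> Some (ray \<kappa> s u) \<notin> V"
    using assms unfolding limit_set_iff by blast
  have "open {z. Some z \<in> V}"
    using openin_continuous_map_preimage[OF continuous_map_Some[of euclidean] t(2)[unfolded riemann_sphere_def]]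
    by simp
  then obtain e where "0 < e" "ball p e \<subseteq> {z. Some z \<in> V}"
    by (rule openE[of _ p]) (use t(3) in auto)
  have "e \<le> norm (ray \<kappa> s u - p)" if "0 < u" "u < t" for u
  proof (rule ccontr)
    assume "\<not> e \<le> norm (ray \<kappa> s u - p)"
    then have "ray \<kappa> s u \<in> ball p e" by (simp add: dist_norm norm_minus_commute)
    then show False using \<open>ball p e \<subseteq> _\<close> t(4)[OF that] by blast
  qed
  then show thesis using that \<open>0 < t\<close> \<open>0 < e\<close> by blast
qed

text \<open>A neighbourhood of infinity is the complement of a compact set; if the ray avoids it
  near 0, the ray stays in that compact set.\<close>

lemma bounded_limit_set:
  assumes "None \<notin> limit_set \<kappa> s"
  obtains t M where "0 < t" "\<And>u. 0 < u \<Longrightarrow> u < t \<Longrightarrow> norm (ray \<kappa> s u) \<le> M"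
proof -
  obtain t V where t: "0 < t" "openin riemann_sphere V" "None \<in> V"
    "\<And>u. 0 < u \<Longrightarrow> u < t \<Longrightarrow> Some (ray \<kappa> s u) \<notin> V"
    using assms unfolding limit_set_iff by blast
  then obtain C where "compact C" "V = insert None (Some ` (- C))"
    unfolding riemann_sphere_def openin_Alexandroff_compactification
    by (auto simp: Compl_eq_Diff_UNIV)
  then obtain M where "\<And>z. z \<in> C \<Longrightarrow> norm z \<le> M" 
    using compact_imp_bounded bounded_iff by metis
  then show thesis
    using that[of t M] t \<open>V = _\<close> by auto
qed

text \<open>The infimum \<open>t_min s\<close> is finite, so \<open>real_of_ereal\<close> returns
  its true value, and some admissible potential lies strictly below the given one.\<close>

lemma ray_parameter_mem_X:
  assumes "exp_bounded s" "0 < u"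
  shows "(s, u + real_of_ereal (t_min s)) \<in> X"
proof -
  have "0 \<le> t_min s"
    unfolding t_min_def by (intro INF_greatest) (auto simp: Xbar_def)
  then obtain r where r: "t_min s = ereal r"
    using assms(1) by (cases "t_min s") (auto simp: exp_bounded_def)
  then have "t_min s < ereal (u + r)" using \<open>0 < u\<close> by simp
  then obtain t where "(s, t) \<in> Xbar" "t < u + r"
    unfolding t_min_def INF_less_iff by auto
  then show ?thesis using X_if_greater r by simp
qed

section \<open>Pulling back along an escaping orbit\<close>

text \<open>Correcting z by a difference of two principal logarithms selects a preimage of v close
  to z, whatever strip z lies in.\<close>

lemma logarithm_relative:
  assumes "v \<noteq> \<kappa>"
  shows "exp_map \<kappa> (z + (Ln (v - \<kappa>) - Ln (exp_map \<kappa> z - \<kappa>))) = v"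
  using assms by (simp add: exp_map_def exp_add exp_diff)

text \<open>The inverse branches along the orbit of z halve distances, because the relevant points
  have real part at least 2 after subtracting \<kappa>.\<close>

lemma pull_back_along_orbit:
  assumes large: "\<And>m. norm \<kappa> + 10 \<le> Re ((exp_map \<kappa> ^^ m) z)"
    and "norm (v - (exp_map \<kappa> ^^ n) z) \<le> 8"
  shows "\<exists>y. (exp_map \<kappa> ^^ n) y = v \<and> norm (y - z) \<le> 8 / 2 ^ n"
proof -
  have "\<exists>y. (exp_map \<kappa> ^^ n) y = v \<and> norm (y - z) \<le> norm (v - (exp_map \<kappa> ^^ n) z) / 2 ^ n"
    using assms(2)
  proof (induction n arbitrary: v)
    case (Suc n)
    define z' where "z' = (exp_map \<kappa> ^^ n) z"
    define w where "w = exp_map \<kappa> z'"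
    have near: "norm (v - w) \<le> 8" using Suc.prems by (simp add: w_def z'_def)
    \<comment> \<open>The margin 10 is the radius 8 plus the bound 2 that makes the logarithm a
      contraction by 1/2.\<close>
    have "norm \<kappa> + 10 \<le> Re w" using large[of "Suc n"] by (simp add: w_def z'_def)
    moreover have "\<bar>Re (v - w)\<bar> \<le> 8" using abs_Re_le_cmod near by (rule order_trans)
    moreover have "Re \<kappa> \<le> norm \<kappa>" by (rule complex_Re_le_cmod)
    ultimately have Re: "2 \<le> Re (v - \<kappa>)" "2 \<le> Re (w - \<kappa>)" unfolding minus_complex.simps by linarith+
    define v' where "v' = z' + (Ln (v - \<kappa>) - Ln (w - \<kappa>))"
    have "norm (Ln (v - \<kappa>) - Ln (w - \<kappa>)) \<le> norm ((v - \<kappa>) - (w - \<kappa>)) / 2"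
    proof (rule norm_Ln_diff_le[of "{x. 2 \<le> Re x}"])
      show "2 \<le> norm x" if "x \<in> {x. 2 \<le> Re x}" for x
        using complex_Re_le_cmod[of x] that by simp
    qed (use Re in \<open>auto simp: convex_halfspace_Re_ge complex_nonpos_Reals_iff\<close>)
    then have v': "norm (v' - z') \<le> norm (v - w) / 2" by (simp add: v'_def)
    then obtain y where y: "(exp_map \<kappa> ^^ n) y = v'" "norm (y - z) \<le> norm (v' - z') / 2 ^ n"
      using Suc.IH[of v'] near by (auto simp: z'_def)
    have "v \<noteq> \<kappa>" using Re by auto
    then have "exp_map \<kappa> v' = v" unfolding v'_def w_def by (rule logarithm_relative)
    moreover have "norm (v' - z') / 2 ^ n \<le> norm (v - w) / 2 / 2 ^ n"
      by (intro divide_right_mono v') simp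
    ultimately show ?case
      using y by (intro exI[of _ y]) (auto simp: w_def z'_def mult_ac)
  qed auto
  moreover have "norm (v - (exp_map \<kappa> ^^ n) z) / 2 ^ n \<le> 8 / 2 ^ n"
    by (intro divide_right_mono assms) simp
  ultimately show ?thesis using order_trans by blast
qed

text \<open>A translate of \<open>b\<close> by a period of the exponential has about the same modulus as the
  image of \<open>z\<close>, and then its logarithm lies near \<open>z\<close>.\<close>

lemma translate_has_preimage_near:
  assumes b: "norm (b - \<kappa>) \<le> M" and large: "2 * (2 * pi + M) \<le> exp (Re z)"
  shows "\<exists>v. norm (v - z) \<le> 8 \<and> exp (exp_map \<kappa> v) = exp b"
proof -
  define A where "A = exp (Re z)"
  have A: "0 < A" "norm (exp_map \<kappa> z - \<kappa>) = A" by (simp_all add: A_def exp_map_def)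
  \<comment> \<open>The largest number of periods of total length at most A; the translated point
    then has distance from \<kappa> within \<open>2 * pi + M\<close>, hence within A/2, of
    A.\<close>
  define k where "k = \<lfloor>A / (2 * pi)\<rfloor>"
  define w where "w = b + of_real (of_int (2 * k) * pi) * \<i>"
  have exp_w: "exp w = exp b" unfolding exp_eq w_def by blast
  have "real_of_int k \<le> A / (2 * pi)" "A / (2 * pi) < real_of_int k + 1"
    unfolding k_def by linarith+
  then have k: "2 * pi * real_of_int k \<le> A" "A < 2 * pi * real_of_int k + 2 * pi"
    by (simp_all add: field_simps)
  have "0 \<le> k" using A unfolding k_def by simp
  then have norm_k: "norm (of_real (of_int (2 * k) * pi) * \<i>) = 2 * pi * real_of_int k"
    by (simp add: norm_mult mult_ac)
  have "w - \<kappa> - of_real (of_int (2 * k) * pi) * \<i> = b - \<kappa>" by (simp add: w_def)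
  then have "\<bar>norm (w - \<kappa>) - 2 * pi * real_of_int k\<bar> \<le> M"
    using norm_triangle_ineq3[of "w - \<kappa>" "of_real (of_int (2 * k) * pi) * \<i>"] b unfolding norm_k by (metis order_trans)
  then have mod: "A / 2 \<le> norm (w - \<kappa>)" "norm (w - \<kappa>) \<le> 2 * A"
    using k large A(1) unfolding A_def[symmetric] distrib_left by linarith+
  have e: "2 \<le> exp (1::real)" using exp_ge_add_one_self[of 1] by simp
  have pos: "0 < norm (w - \<kappa>)" using mod A by linarith
  have "norm (w - \<kappa>) \<le> exp (1 + ln A)" "exp (ln A - 1) \<le> norm (w - \<kappa>)"
  proof -
    have "2 * A \<le> exp 1 * A" using e A by simp
    then show "norm (w - \<kappa>) \<le> exp (1 + ln A)" using mod A by (simp only: exp_add exp_ln)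
    have "A / exp 1 \<le> A / 2" using e A by (intro divide_left_mono) auto
    then show "exp (ln A - 1) \<le> norm (w - \<kappa>)" using mod A by (simp only: exp_diff exp_ln)
  qed
  then have "\<bar>ln (norm (w - \<kappa>)) - ln A\<bar> \<le> 1"
    using pos ln_le_cancel_iff[of "norm (w - \<kappa>)" "exp (1 + ln A)"]
      ln_le_cancel_iff[of "exp (ln A - 1)" "norm (w - \<kappa>)"] by simp
  moreover have ne: "w - \<kappa> \<noteq> 0" "exp_map \<kappa> z - \<kappa> \<noteq> 0" using pos A by auto
  ultimately have Re: "\<bar>Re (Ln (w - \<kappa>) - Ln (exp_map \<kappa> z - \<kappa>))\<bar> \<le> 1"
    by (simp add: A)
  have "\<bar>Im (Ln (w - \<kappa>) - Ln (exp_map \<kappa> z - \<kappa>))\<bar> \<le> 2 * pi"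
    using mpi_less_Im_Ln[OF ne(1)] mpi_less_Im_Ln[OF ne(2)] Im_Ln_le_pi[OF ne(1)] Im_Ln_le_pi[OF ne(2)]
    unfolding minus_complex.simps by linarith
  \<comment> \<open>The radius 8 comes from here: 1 for the real part and 2 pi, at most 7, for the
    imaginary part.\<close>
  moreover have "pi \<le> 7 / 2" using pi_approx(2) by (rule order_trans) simp
  ultimately have "norm (Ln (w - \<kappa>) - Ln (exp_map \<kappa> z - \<kappa>)) \<le> 8"
    using Re cmod_le[of "Ln (w - \<kappa>) - Ln (exp_map \<kappa> z - \<kappa>)"] by linarith
  moreover have "exp_map \<kappa> (z + (Ln (w - \<kappa>) - Ln (exp_map \<kappa> z - \<kappa>))) = w"
    by (rule logarithm_relative) (use ne in auto)
  ultimately show ?thesis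
    using exp_w by (intro exI[of _ "z + (Ln (w - \<kappa>) - Ln (exp_map \<kappa> z - \<kappa>))"]) simp
qed

lemma norm_Ln_le:
  assumes "0 < e" "e \<le> norm z" "norm z \<le> M"
  shows "norm (Ln z) \<le> \<bar>ln e\<bar> + \<bar>ln M\<bar> + pi"
proof -
  have ne: "z \<noteq> 0" using assms by auto
  have "ln e \<le> ln (norm z)" "ln (norm z) \<le> ln M"
    using assms by (simp_all add: ne)
  then have "\<bar>Re (Ln z)\<bar> \<le> \<bar>ln e\<bar> + \<bar>ln M\<bar>" using ne by simp
  moreover have "\<bar>Im (Ln z)\<bar> \<le> pi"
    using mpi_less_Im_Ln[OF ne] Im_Ln_le_pi[OF ne] by simp
  ultimately show ?thesis using cmod_le[of "Ln z"] by linarith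
qed

lemma bounded_exp_map_iter_cball:
  obtains B where "\<And>z. z \<in> cball c r \<Longrightarrow> norm ((exp_map \<kappa> ^^ n) z) \<le> B"
proof -
  have "continuous_on (cball c r) (\<lambda>z. (exp_map \<kappa> ^^ n) z)"
    by (induction n) (auto simp: exp_map_def intro!: continuous_intros)
  then have "bounded ((\<lambda>z. (exp_map \<kappa> ^^ n) z) ` cball c r)"
    by (intro compact_imp_bounded compact_continuous_image) auto
  then show thesis using that unfolding bounded_iff by blast
qed

lemma g_frak_iter:
  assumes "nonescaping \<kappa>" "x \<in> X"
  shows "g_frak \<kappa> ((model_map ^^ n) x) = (exp_map \<kappa> ^^ n) (g_frak \<kappa> x)"
  by (induction n) (simp_all add: g_frak_properties[OF assms(1)] model_map_iter_mem_X[OF assms(2)])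

section \<open>Discontinuity of the conjugacy\<close>

theorem theorem8p6:
  fixes s :: address and \<kappa> \<kappa>' :: complex
  assumes "exp_bounded s"
    and "nonescaping \<kappa>'"
    and "Some \<kappa>' \<in> limit_set \<kappa>' s"
    and "nonescaping \<kappa>"
    and "Some \<kappa> \<notin> limit_set \<kappa> s"
    and "None \<notin> limit_set \<kappa> s"
  shows "\<not> continuous_on (escaping_set \<kappa>) (g_frak \<kappa>' \<circ> inv_into X (g_frak \<kappa>))"
proof
  define \<Phi> where "\<Phi> = g_frak \<kappa>' \<circ> inv_into X (g_frak \<kappa>)"
  assume "continuous_on (escaping_set \<kappa>) (g_frak \<kappa>' \<circ> inv_into X (g_frak \<kappa>))"
  then have cont: "continuous_on (escaping_set \<kappa>) \<Phi>" by (simp add: \<Phi>_def)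
  note bij = g_frak_properties(1)[OF \<open>nonescaping \<kappa>\<close>]
  define p where "p u = (s, u + real_of_ereal (t_min s))" for u
  have p: "p u \<in> X" if "0 < u" for u
    using ray_parameter_mem_X[OF \<open>exp_bounded s\<close> that] by (simp add: p_def)
  have ray: "ray \<mu> s u = g_frak \<mu> (p u)" for \<mu> u by (simp add: ray_def p_def)
  obtain t1 e where t1: "0 < t1" "0 < e" "\<And>u. 0 < u \<Longrightarrow> u < t1 \<Longrightarrow> e \<le> norm (ray \<kappa> s u - \<kappa>)"
    using not_in_limit_set[OF \<open>Some \<kappa> \<notin> limit_set \<kappa> s\<close>] by blast
  obtain t2 M where t2: "0 < t2" "\<And>u. 0 < u \<Longrightarrow> u < t2 \<Longrightarrow> norm (ray \<kappa> s u) \<le> M"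
    using bounded_limit_set[OF \<open>None \<notin> limit_set \<kappa> s\<close>] by blast
  \<comment> \<open>A bound for \<open>norm (b - \<kappa>)\<close> valid for all small
    \<open>u\<close>: the ray stays at distance at least \<open>e\<close> from \<kappa> and is
    bounded by \<open>M\<close>. Since \<open>C\<close> does not depend on \<open>u\<close>, the
    base point z can be fixed before \<open>u\<close>.\<close>
  define M' where "M' = \<bar>ln e\<bar> + \<bar>ln (M + norm \<kappa>)\<bar> + pi + norm \<kappa>"
  define C where "C = 2 * (2 * pi + M')"
  have "0 \<le> C" by (simp add: C_def M'_def add_nonneg_nonneg)
  \<comment> \<open>Any escaping point serves as a start; z will be an iterate whose whole orbit
    lies far to the right.\<close>
  have "g_frak \<kappa> (p 1) \<in> escaping_set \<kappa>"
    using bij p[of 1] by (simp add: bij_betw_apply)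
  then obtain N where N: "norm \<kappa> + 10 + C \<le> Re ((exp_map \<kappa> ^^ (m + N)) (g_frak \<kappa> (p 1)))" for m
    using escaping_large_orbit[of _ \<kappa> "norm \<kappa> + 10 + C"] by blast
  define z where "z = (exp_map \<kappa> ^^ N) (g_frak \<kappa> (p 1))"
  have z: "z \<in> escaping_set \<kappa>"
    using \<open>g_frak \<kappa> (p 1) \<in> escaping_set \<kappa>\<close> by (simp add: z_def exp_map_iter_escaping_iff)
  have large: "norm \<kappa> + 10 + C \<le> Re ((exp_map \<kappa> ^^ m) z)" for m
    using N[of m] by (simp add: z_def funpow_add)
  \<comment> \<open>The order of choices matters: continuity at z gives \<open>d\<close>, then
    \<open>n\<close> makes the pulled-back point \<open>d\<close>-close, \<open>B\<close> depends
    only on \<open>n\<close>, and \<open>u\<close> is chosen last.\<close>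
  obtain d where d: "0 < d" "\<And>y. y \<in> escaping_set \<kappa> \<Longrightarrow> dist y z < d \<Longrightarrow> dist (\<Phi> y) (\<Phi> z) < 1"
    using cont z unfolding continuous_on_iff by (metis zero_less_one)
  obtain n where n: "8 / 2 ^ n < d"
    using d(1) order_tendstoD(2)[OF LIMSEQ_divide_realpow_zero[of 2 8], of d]
    by (auto simp: eventually_sequentially)
  obtain B where B: "\<And>y. y \<in> cball (\<Phi> z) 1 \<Longrightarrow> norm ((exp_map \<kappa>' ^^ Suc n) y) \<le> B"
    using bounded_exp_map_iter_cball by blast
  \<comment> \<open>On the side of \<kappa>' the ray comes so close to the singular value that every
    logarithm of the difference has real part below -B. The bound by \<open>min t1 t2\<close>
    retains both estimates on the side of \<kappa>.\<close>
  obtain u where u: "0 < u" "u < min t1 t2" "norm (ray \<kappa>' s u - \<kappa>') < exp (- B)"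
    using limit_set_finite_point[OF \<open>Some \<kappa>' \<in> limit_set \<kappa>' s\<close>, of "min t1 t2" "exp (- B)"] t1 t2 by auto
  define b where "b = Ln (ray \<kappa> s u - \<kappa>)"
  have dist_\<kappa>: "e \<le> norm (ray \<kappa> s u - \<kappa>)" using t1 u by simp
  have exp_b: "exp b = ray \<kappa> s u - \<kappa>" unfolding b_def using dist_\<kappa> t1(2) by (intro exp_Ln) auto
  have "norm b \<le> \<bar>ln e\<bar> + \<bar>ln (M + norm \<kappa>)\<bar> + pi"
    unfolding b_def
  proof (rule norm_Ln_le[OF t1(2) dist_\<kappa>])
    show "norm (ray \<kappa> s u - \<kappa>) \<le> M + norm \<kappa>"
      using norm_triangle_ineq4[of "ray \<kappa> s u" \<kappa>] t2(2)[of u] u by simp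
  qed
  then have b: "norm (b - \<kappa>) \<le> M'"
    using norm_triangle_ineq4[of b \<kappa>] by (simp add: M'_def)
  have "C \<le> Re ((exp_map \<kappa> ^^ n) z)" using large[of n] norm_ge_zero[of \<kappa>] by linarith
  also have "\<dots> \<le> exp (Re ((exp_map \<kappa> ^^ n) z))" using exp_ge_add_one_self[of "Re ((exp_map \<kappa> ^^ n) z)"] by linarith
  \<comment> \<open>The image of \<open>v\<close> is a logarithm of
    \<open>ray \<kappa> s u - \<kappa>\<close>, so two steps lead from \<open>v\<close> to the ray
    point and \<open>n + 2\<close> steps from \<open>y\<close>.\<close>
  finally obtain v where v: "norm (v - (exp_map \<kappa> ^^ n) z) \<le> 8" "exp (exp_map \<kappa> v) = exp b"
    using translate_has_preimage_near[OF b] unfolding C_def by blast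
  have "norm \<kappa> + 10 \<le> Re ((exp_map \<kappa> ^^ m) z)" for m
    using large[of m] \<open>0 \<le> C\<close> by linarith
  then obtain y where y: "(exp_map \<kappa> ^^ n) y = v" "norm (y - z) \<le> 8 / 2 ^ n"
    using pull_back_along_orbit[OF _ v(1)] by blast
  have iter_y: "(exp_map \<kappa> ^^ Suc (Suc n)) y = g_frak \<kappa> (p u)"
    using y(1) v(2) exp_b by (simp add: exp_map_def ray)
  then have "y \<in> escaping_set \<kappa>"
    using bij_betw_apply[OF bij p[OF u(1)]] exp_map_iter_escaping_iff by metis
  define x where "x = inv_into X (g_frak \<kappa>) y"
  have "y \<in> g_frak \<kappa> ` X" using \<open>y \<in> escaping_set \<kappa>\<close> bij by (simp add: bij_betw_def)
  then have x: "x \<in> X" "g_frak \<kappa> x = y"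
    unfolding x_def by (rule inv_into_into, rule f_inv_into_f)
  have "g_frak \<kappa> ((model_map ^^ Suc (Suc n)) x) = g_frak \<kappa> (p u)"
    unfolding g_frak_iter[OF \<open>nonescaping \<kappa>\<close> x(1)] x(2) by (rule iter_y)
  \<comment> \<open>Injectivity moves the orbit relation to the model, where it does not depend on
    the parameter and can be read off for \<kappa>'.\<close>
  then have model: "(model_map ^^ Suc (Suc n)) x = p u"
    by (rule inj_onD[OF bij_betw_imp_inj_on[OF bij]]) (use p u model_map_iter_mem_X x in blast)+
  define q where "q = (exp_map \<kappa>' ^^ Suc n) (\<Phi> y)"
  have "exp_map \<kappa>' q = ray \<kappa>' s u"
    using g_frak_iter[OF \<open>nonescaping \<kappa>'\<close> x(1), of "Suc (Suc n)"]
    unfolding model ray by (simp add: q_def \<Phi>_def x_def)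
  then have "exp q = ray \<kappa>' s u - \<kappa>'" by (simp add: exp_map_def eq_diff_eq)
  \<comment> \<open>One step before the ray point the orbit of \<open>\<Phi> y\<close> has modulus
    above \<open>B\<close>, although \<open>\<Phi> y\<close> lies in the unit disc about
    \<open>\<Phi> z\<close>.\<close>
  then have "exp (Re q) < exp (- B)" using u(3) by (metis norm_exp_eq_Re)
  then have "B < norm q" using abs_Re_le_cmod[of q] by simp
  moreover have "norm q \<le> B"
    unfolding q_def
  proof (rule B)
    have "dist (\<Phi> y) (\<Phi> z) < 1"
      using d(2)[OF \<open>y \<in> escaping_set \<kappa>\<close>] y(2) n by (simp add: dist_norm)
    then show "\<Phi> y \<in> cball (\<Phi> z) 1" by (simp add: dist_commute)
  qed
  ultimately show False by simp
qed

end
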